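(* Let $d\ge 2$ and $m\ge 1$. Then there is an $r=r(d,m)>0$ with the following property. Let $P_R$ and $P_G$ be induced paths in $\mathbb{Z}^d$, one red and one green, each starting outside $B_{r+2}$ and ending at a neighbour of $0$, with no red vertex (vertex of $P_R$) adjacent to any green vertex (vertex of $P_G$). Then we may modify the paths inside $B_r$ so that one ends at $-e_m$, the other ends at $e_m$, neither contains any other vertices of $B_m$, and still no red vertex is adjacent to any green vertex.
   Context: This assertion is posed as a conjecture. $\mathbb{Z}^d$ is regarded as a graph with vertices at $\ell_1$-distance $1$ adjacent, and $0$ denotes the origin. $B_k=\{v\in\mathbb{Z}^d:\delta(0,v)\le k\}$ is the closed ball of radius $k$ about the origin, where $\delta$ may be either the $\ell_1$ or the $\ell_\infty$ distance (the same one being used for all balls; either form of the conjecture immediately implies the other). $e_m$ denotes the site $(m,0,\ldots,0)$ and $-e_m$ the site $(-m,0,\ldots,0)$. A path is induced if no two of its non-consecutive vertices are adjacent. Modifying the paths inside $B_r$ means replacing $P_R$ and $P_G$ by a red path $P_R'$ and a green path $P_G'$ with the same respective starting vertices, such that every vertex of $P_R'$ outside $B_r$ is a vertex of $P_R$ and every vertex of $P_G'$ outside $B_r$ is a vertex of $P_G$; after the modification, red and green vertices are the vertices of $P_R'$ and $P_G'$ respectively. *)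

theory Defs
  imports Main
begin

text \<open>
  A point of \<open>\<int>\<^sup>d\<close> is a function \<open>nat \<Rightarrow> int\<close> whose coordinates are those with index below \<open>d\<close>;
  the values at the remaining indices are fixed to be 0, so that function equality
  is equality of points.
\<close>

type_synonym point = "nat \<Rightarrow> int"

definition lattice :: "nat \<Rightarrow> point set" where
  "lattice d = {v. \<forall>i\<ge>d. v i = 0}"

definition l1_dist :: "nat \<Rightarrow> point \<Rightarrow> point \<Rightarrow> int" where
  "l1_dist d x y = (\<Sum>i<d. \<bar>x i - y i\<bar>)"

text \<open>The maximum below is meaningful for \<open>d \<ge> 1\<close> only.\<close>

definition linf_dist :: "nat \<Rightarrow> point \<Rightarrow> point \<Rightarrow> int" where
  "linf_dist d x y = Max ((\<lambda>i. \<bar>x i - y i\<bar>) ` {..<d})"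

definition adjacent :: "nat \<Rightarrow> point \<Rightarrow> point \<Rightarrow> bool" where
  "adjacent d x y \<longleftrightarrow> x \<in> lattice d \<and> y \<in> lattice d \<and> l1_dist d x y = 1"

definition origin :: point where
  "origin = (\<lambda>_. 0)"

definition axis_site :: "int \<Rightarrow> point" where
  "axis_site a = origin(0 := a)"

definition origin_ball :: "nat \<Rightarrow> (point \<Rightarrow> point \<Rightarrow> int) \<Rightarrow> nat \<Rightarrow> point set" where
  "origin_ball d \<delta> k = {v \<in> lattice d. \<delta> origin v \<le> int k}"

definition is_path :: "nat \<Rightarrow> point list \<Rightarrow> bool" where
  "is_path d P \<longleftrightarrow> P \<noteq> [] \<and> set P \<subseteq> lattice d \<and> distinct P \<and> successively (adjacent d) P"

definition induced_path :: "nat \<Rightarrow> point list \<Rightarrow> bool" where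
  "induced_path d P \<longleftrightarrow> is_path d P \<and>
     (\<forall>i j. i + 1 < j \<and> j < length P \<longrightarrow> \<not> adjacent d (P ! i) (P ! j))"

definition no_red_green_adjacent :: "nat \<Rightarrow> point list \<Rightarrow> point list \<Rightarrow> bool" where
  "no_red_green_adjacent d R G \<longleftrightarrow> (\<forall>x\<in>set R. \<forall>y\<in>set G. \<not> adjacent d x y)"

text \<open>The modified path \<open>P'\<close> is a path but need not be induced.\<close>

definition modification_inside :: "nat \<Rightarrow> point set \<Rightarrow> point list \<Rightarrow> point list \<Rightarrow> bool" where
  "modification_inside d B P P' \<longleftrightarrow> is_path d P' \<and> hd P' = hd P \<and> set P' - B \<subseteq> set P"

definition ends_at_only :: "point list \<Rightarrow> point \<Rightarrow> point set \<Rightarrow> bool" where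
  "ends_at_only P v B \<longleftrightarrow> last P = v \<and> set P \<inter> B \<subseteq> {v}"

end

theory Submission
  imports Defs "HOL-Library.FuncSet"
begin

text \<open>
  The idea is that two paths can be continued at will inside an \<open>l1\<close> ball as soon as both have
  entered it, with a single exception.  Let the first vertices of the red and the green path in
  the ball of radius \<open>C\<close> about \<open>z\<close> be \<open>a\<close> and \<open>b\<close>; both lie on the sphere.  Call the pair bad for
  the signed unit vector \<open>w\<close> if one of \<open>a\<close>, \<open>b\<close> is the tip \<open>z + C w\<close> of the ball and the other is a
  neighbour of \<open>z + (C - 1) w\<close>, the only vertex through which the tip can be left inwards.  If the
  pair is bad for no \<open>w\<close>, choose \<open>p\<close> such that \<open>a\<close> reaches further than \<open>b\<close> in direction \<open>p\<close>, and \<open>q\<close>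
  the other way round.  Red trades its other coordinates for \<open>p\<close> and then follows the \<open>p\<close>-axis
  inwards, green does the same with \<open>q\<close>, and the two routes never come near each other
  (\<open>arms_apart\<close>).  What the paths did before lies outside the ball and cannot interfere with
  vertices strictly inside.  Two such passages and a final turn onto the first axis finish the
  construction for every ball that is large compared with the distance of its centre from the
  origin (\<open>win_from_ball\<close>).

  Suppose now that the modification is impossible for some pair of paths.  Then all large balls
  with centre near the origin have bad entries; the direction \<open>w\<close> is unique and is called the label.
  A ball with label \<open>w\<close> contains the ball of radius \<open>C - 1\<close> about \<open>z + w\<close>, which has the same two
  entries and hence the same label (\<open>label_down\<close>).  Some label \<open>w\<close> occurs in every moderately large
  region of centres, so the tips of the large balls with label \<open>w\<close> form a relatively dense
  set in a region far out in direction \<open>w\<close>.  A small ball in this region sticks out of a large ball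
  that is entered no earlier, and continuing from the small ball into the large one shows that
  the small ball has bad entries too (\<open>label_small\<close>).  So in some region all balls with
  \<open>C0 \<le> C \<le> C0 + 2 d\<close> are labelled, where the region is as large as desired in terms of \<open>C0\<close>.

  This is contradictory for a reason that has nothing to do with paths (\<open>tips_everywhere\<close>).
  Moving every centre one step in the direction of its label is injective from the balls of radius
  \<open>C\<close> to those of radius \<open>C - 1\<close>, so it misses few centres of a large box, and in some smaller box
  it misses none.  There, for \<open>0 \<le> k < 2 d\<close>, the number of \<open>w\<close> such that \<open>x + k w\<close> has label \<open>w\<close> at radius
  \<open>C0\<close> equals the number of labels of \<open>x\<close> at radius \<open>C0 + k\<close>, which is one.  As a function of \<open>k\<close> and \<open>x\<close>
  this number satisfies a linear recurrence of order \<open>2 d\<close> that can be run backwards, and so it is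
  one for \<open>k = - C0\<close> as well: every vertex \<open>x\<close> of some region is the tip \<open>(x - C0 w) + C0 w\<close> of a
  labelled ball, and thus is red or green.  A vertex and all its \<open>2 d \<ge> 4\<close> neighbours cannot be
  coloured by two induced paths without a red-green adjacency.
\<close>

section \<open>Signed directions and the l1 distance\<close>

type_synonym dir = "nat \<times> int"

definition opp :: "dir \<Rightarrow> dir" where "opp u = (fst u, - snd u)"

text \<open>
  Measuring a point by the positive parts of its \<open>2 d\<close> signed coordinates turns the distance into a
  plain sum of differences (\<open>dist1_part\<close>) and treats all orthants alike.
\<close>

definition part :: "point \<Rightarrow> point \<Rightarrow> dir \<Rightarrow> int" where
  "part z x u = max 0 (snd u * (x (fst u) - z (fst u)))"

definition shift :: "point \<Rightarrow> dir \<Rightarrow> int \<Rightarrow> point" where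
  "shift x u k = x(fst u := x (fst u) + k * snd u)"

text \<open>
  The exceptional position of the two entries.  The only step from the tip \<open>z + C w\<close> into the
  interior of the ball leads to \<open>z + (C - 1) w\<close>, which the other entry blocks.
\<close>

definition bad_pair :: "nat \<Rightarrow> point \<Rightarrow> int \<Rightarrow> dir \<Rightarrow> point \<Rightarrow> point \<Rightarrow> bool" where
  "bad_pair d z C w a b \<longleftrightarrow>
     a = shift z w C \<and> adjacent d b (shift z w (C - 1)) \<or>
     b = shift z w C \<and> adjacent d a (shift z w (C - 1))"

locale grid =
  fixes d :: nat
  assumes two_le_d: "2 \<le> d"
begin

definition dirs :: "dir set" where "dirs = {..<d} \<times> {1, -1}"

abbreviation L :: "point set" where "L \<equiv> lattice d"
abbreviation dist1 :: "point \<Rightarrow> point \<Rightarrow> int" where "dist1 \<equiv> l1_dist d"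
abbreviation adj :: "point \<Rightarrow> point \<Rightarrow> bool" where "adj \<equiv> adjacent d"

definition ball1 :: "point \<Rightarrow> int \<Rightarrow> point set" where
  "ball1 z C = {x \<in> L. dist1 z x \<le> C}"

lemma finite_dirs [simp]: "finite dirs"
  by (simp add: dirs_def)

lemma card_dirs: "card dirs = 2 * d"
  by (simp add: dirs_def card_cartesian_product)

lemma dirsD: "u \<in> dirs \<Longrightarrow> fst u < d \<and> (snd u = 1 \<or> snd u = -1)"
  by (auto simp: dirs_def)

lemma opp_dirs [simp]: "opp u \<in> dirs \<longleftrightarrow> u \<in> dirs"
  by (cases u) (auto simp: opp_def dirs_def)

lemma opp_opp [simp]: "opp (opp u) = u"
  by (simp add: opp_def)

lemma opp_neq: "u \<in> dirs \<Longrightarrow> opp u \<noteq> u"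
  by (cases u) (auto simp: opp_def dirs_def)

lemma sum_dirs: "(\<Sum>u\<in>dirs. f u) = (\<Sum>i<d. f (i, 1) + f (i, -1))"
  for f :: "dir \<Rightarrow> int"
proof -
  have "(\<Sum>u\<in>dirs. f u) = (\<Sum>i<d. \<Sum>s\<in>{1, -1}. f (i, s))"
    unfolding dirs_def by (subst sum.cartesian_product) simp
  then show ?thesis by simp
qed

lemma dist1_part: "dist1 x y = (\<Sum>u\<in>dirs. \<bar>part z x u - part z y u\<bar>)"
  unfolding sum_dirs l1_dist_def
  by (rule sum.cong) (auto simp: part_def max_def)

lemma part_self [simp]: "part z z u = 0"
  by (simp add: part_def)

lemma part_nonneg [simp]: "0 \<le> part z x u"
  by (simp add: part_def)

lemma dist1_centre: "dist1 z y = (\<Sum>u\<in>dirs. part z y u)"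
  using dist1_part[of z y z] by simp

lemma dist1_commute: "dist1 x y = dist1 y x"
  unfolding l1_dist_def by (rule sum.cong) auto

lemma dist1_triangle: "dist1 x z \<le> dist1 x y + dist1 y z"
  unfolding l1_dist_def sum.distrib[symmetric] by (rule sum_mono) auto

lemma dist1_nonneg [simp]: "0 \<le> dist1 x y"
  unfolding l1_dist_def by (rule sum_nonneg) auto

lemma dist1_self [simp]: "dist1 x x = 0"
  unfolding l1_dist_def by simp

lemma dist1_eq_0: "x \<in> L \<Longrightarrow> y \<in> L \<Longrightarrow> dist1 x y = 0 \<Longrightarrow> x = y"
proof -
  assume a: "x \<in> L" "y \<in> L" "dist1 x y = 0"
  then have "\<forall>i\<in>{..<d}. \<bar>x i - y i\<bar> = 0"
    unfolding l1_dist_def by (subst (asm) sum_nonneg_eq_0_iff) auto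
  show "x = y"
  proof
    fix i show "x i = y i"
      by (cases "i < d") (use a \<open>\<forall>i\<in>_. _\<close> in \<open>auto simp: lattice_def\<close>)
  qed
qed

lemma point_eqI:
  assumes "x \<in> L" "y \<in> L" "\<And>u. u \<in> dirs \<Longrightarrow> part z x u = part z y u"
  shows "x = y"
  using dist1_eq_0[OF assms(1,2)] dist1_part[of x y z] assms(3) by simp

lemma adj_iff: "adj x y \<longleftrightarrow> x \<in> L \<and> y \<in> L \<and> dist1 x y = 1"
  by (simp add: adjacent_def)

lemma adj_commute: "adj x y \<longleftrightarrow> adj y x"
  by (auto simp: adj_iff dist1_commute)

lemma shift_L [simp]: "u \<in> dirs \<Longrightarrow> shift x u k \<in> L \<longleftrightarrow> x \<in> L"
  using dirsD[of u] by (auto simp: lattice_def shift_def)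

lemma shift_0 [simp]: "shift x u 0 = x"
  by (simp add: shift_def)

lemma shift_shift [simp]: "shift (shift x u k) u l = shift x u (k + l)"
  by (auto simp: shift_def algebra_simps)

lemma shift_opp: "shift x (opp u) k = shift x u (- k)"
  by (auto simp: shift_def opp_def)

lemma dist1_shift: "u \<in> dirs \<Longrightarrow> dist1 (shift x u k) (shift x u l) = \<bar>k - l\<bar>"
proof -
  assume u: "u \<in> dirs"
  have "dist1 (shift x u k) (shift x u l) = (\<Sum>i<d. if i = fst u then \<bar>k - l\<bar> else 0)"
    unfolding l1_dist_def
    by (rule sum.cong) (use dirsD[OF u] in \<open>auto simp: shift_def\<close>)
  then show ?thesis using dirsD[OF u] by simp
qed

lemma dist1_shift_both: "dist1 (shift x u k) (shift y u k) = dist1 x y"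
  unfolding l1_dist_def by (rule sum.cong) (auto simp: shift_def)

lemma adj_shift: "u \<in> dirs \<Longrightarrow> x \<in> L \<Longrightarrow> \<bar>k - l\<bar> = 1 \<Longrightarrow> adj (shift x u k) (shift x u l)"
  by (simp add: adj_iff dist1_shift)

lemma part_shift_centre:
  assumes "u \<in> dirs" "v \<in> dirs" "0 \<le> k"
  shows "part z (shift z u k) v = (if v = u then k else 0)"
  using assms dirsD[OF assms(1)] dirsD[OF assms(2)]
  by (cases u; cases v) (auto simp: part_def shift_def)

lemma part_shift_down:
  assumes "u \<in> dirs" "v \<in> dirs" "1 \<le> part z x u"
  shows "part z (shift x u (-1)) v = part z x v - (if v = u then 1 else 0)"
  using assms dirsD[OF assms(1)] dirsD[OF assms(2)]
  by (cases u; cases v) (auto simp: part_def shift_def)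

lemma part_shift_up:
  assumes "u \<in> dirs" "v \<in> dirs" "part z x (opp u) = 0"
  shows "part z (shift x u 1) v = part z x v + (if v = u then 1 else 0)"
  using assms dirsD[OF assms(1)] dirsD[OF assms(2)]
  by (cases u; cases v) (auto simp: part_def shift_def opp_def)

lemma part_opp: "0 < part z x u \<Longrightarrow> part z x (opp u) = 0"
  by (auto simp: part_def opp_def max_def split: if_splits)

lemma dist1_shift_down:
  assumes "u \<in> dirs" "1 \<le> part z x u"
  shows "dist1 z (shift x u (-1)) = dist1 z x - 1"
proof -
  have "dist1 z (shift x u (-1)) = (\<Sum>v\<in>dirs. part z x v - (if v = u then 1 else 0))"
    unfolding dist1_centre by (rule sum.cong) (auto simp: part_shift_down assms)
  then show ?thesis using assms by (simp add: sum_subtractf dist1_centre)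
qed

lemma dist1_shift_up:
  assumes "u \<in> dirs" "part z x (opp u) = 0"
  shows "dist1 z (shift x u 1) = dist1 z x + 1"
proof -
  have "dist1 z (shift x u 1) = (\<Sum>v\<in>dirs. part z x v + (if v = u then 1 else 0))"
    unfolding dist1_centre by (rule sum.cong) (auto simp: part_shift_up assms)
  then show ?thesis using assms by (simp add: sum.distrib dist1_centre)
qed

lemma dist1_shift_centre [simp]: "u \<in> dirs \<Longrightarrow> dist1 z (shift z u k) = \<bar>k\<bar>"
  using dist1_shift[of u z 0 k] by simp

lemma part_le_dist1: "u \<in> dirs \<Longrightarrow> part z x u \<le> dist1 z x"
  unfolding dist1_centre by (rule member_le_sum) auto

lemma tip_iff:
  assumes "x \<in> L" "z \<in> L" "u \<in> dirs"
  shows "x = shift z u (dist1 z x) \<longleftrightarrow> part z x u = dist1 z x"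
proof
  assume "x = shift z u (dist1 z x)"
  then have "part z x u = part z (shift z u (dist1 z x)) u" by simp
  also have "\<dots> = dist1 z x" by (subst part_shift_centre) (use assms in auto)
  finally show "part z x u = dist1 z x" .
next
  assume p: "part z x u = dist1 z x"
  have *: "part z x v = 0" if "v \<in> dirs" "v \<noteq> u" for v
  proof -
    have "(\<Sum>v\<in>dirs. part z x v) = part z x u + (\<Sum>v\<in>dirs - {u}. part z x v)"
      using assms by (simp add: sum.remove)
    then have "(\<Sum>v\<in>dirs - {u}. part z x v) = 0" using p by (simp add: dist1_centre)
    then show ?thesis using that by (subst (asm) sum_nonneg_eq_0_iff) auto
  qed
  show "x = shift z u (dist1 z x)"
    by (rule point_eqI[of _ _ z]) (use assms p * in \<open>auto simp: part_shift_centre\<close>)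
qed

end

section \<open>Walks inside a ball that stay apart\<close>

context grid begin

definition walk :: "point list \<Rightarrow> bool" where
  "walk W \<longleftrightarrow> W \<noteq> [] \<and> set W \<subseteq> L \<and> successively adj W"

lemma walk_Cons: "x \<in> L \<Longrightarrow> walk W \<Longrightarrow> adj x (hd W) \<Longrightarrow> walk (x # W)"
  by (cases W) (auto simp: walk_def)

lemma walk_singleton [simp]: "walk [x] \<longleftrightarrow> x \<in> L"
  by (simp add: walk_def)

lemma walk_append: "walk V \<Longrightarrow> walk W \<Longrightarrow> adj (last V) (hd W) \<Longrightarrow> walk (V @ W)"
  by (auto simp: walk_def successively_append_iff)

lemma walk_join:
  assumes "walk V" "walk W" "last V = hd W"
  shows "walk (V @ tl W)" "hd (V @ tl W) = hd V" "last (V @ tl W) = last W"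
    "set (V @ tl W) = set V \<union> set W"
proof -
  obtain x X where W: "W = x # X" using assms by (cases W) (auto simp: walk_def)
  have V: "V \<noteq> []" "last V = x" using assms W by (auto simp: walk_def)
  then have "x \<in> set V" by auto
  then show "set (V @ tl W) = set V \<union> set W" using W by auto
  show "walk (V @ tl W)"
  proof (cases X)
    case (Cons y Y)
    then show ?thesis using assms W V
      by (auto simp: walk_def successively_append_iff)
  qed (use assms W in simp)
  show "hd (V @ tl W) = hd V" using V by simp
  show "last (V @ tl W) = last W" using V W by (cases X) auto
qed

lemma axis_walk:
  assumes "u \<in> dirs" "z \<in> L" "l \<le> k"
  shows "\<exists>W. walk W \<and> hd W = shift z u k \<and> last W = shift z u l \<and>
    set W \<subseteq> {shift z u s |s. l \<le> s \<and> s \<le> k}"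
  using assms(3)
proof (induction "nat (k - l)" arbitrary: k)
  case 0
  then have "k = l" by simp
  then show ?case using assms by (intro exI[of _ "[shift z u k]"]) auto
next
  case (Suc n)
  from Suc(1)[of "k - 1"] Suc(2,3) obtain W where W: "walk W" "hd W = shift z u (k - 1)"
    "last W = shift z u l" "set W \<subseteq> {shift z u s |s. l \<le> s \<and> s \<le> k - 1}" by force
  have "walk (shift z u k # W)"
    by (rule walk_Cons) (use W assms in \<open>auto intro!: adj_shift\<close>)
  moreover have "W \<noteq> []" using W by (simp add: walk_def)
  moreover have "set (shift z u k # W) \<subseteq> {shift z u s |s. l \<le> s \<and> s \<le> k}"
    using W(4) Suc(3) by fastforce
  ultimately show ?case using W by (intro exI[of _ "shift z u k # W"]) auto
qed

lemma other_direction: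
  assumes "p \<in> dirs" "q \<in> dirs" "p \<noteq> q" "part z x p \<noteq> dist1 z x"
  shows "\<exists>u. u \<in> dirs \<and> u \<noteq> p \<and> 1 \<le> part z x u \<and> (0 < part z x q \<longrightarrow> u = q)"
proof (cases "0 < part z x q")
  case True
  then show ?thesis using assms by (intro exI[of _ q]) auto
next
  case False
  have "\<exists>u\<in>dirs - {p}. 0 < part z x u"
  proof (rule ccontr)
    assume "\<not> ?thesis"
    then have "\<forall>u\<in>dirs - {p}. part z x u = 0" by (meson not_le order_antisym part_nonneg)
    then have "(\<Sum>u\<in>dirs - {p}. part z x u) = 0" by simp
    then show False using assms(1,4) by (simp add: dist1_centre sum.remove)
  qed
  then show ?thesis using False by force
qed

text \<open>
  Alternately giving up one unit of another direction and gaining one unit of \<open>p\<close> leads to the axis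
  while the walk uses only two consecutive distances from \<open>z\<close>.  The units of \<open>q\<close> are given up first;
  this order is what keeps the walk away from the \<open>q\<close>-axis in \<open>axis_slice_apart\<close>.
\<close>

lemma zigzag:
  assumes "p \<in> dirs" "q \<in> dirs" "p \<noteq> q" "x \<in> L" "z \<in> L" "part z x (opp p) = 0"
  shows "\<exists>W. walk W \<and> hd W = x \<and> last W = shift z p (dist1 z x) \<and>
    (\<forall>y\<in>set W. dist1 z x - 1 \<le> dist1 z y \<and> dist1 z y \<le> dist1 z x \<and>
       part z x p \<le> part z y p \<and> (\<forall>u\<in>dirs - {p}. part z y u \<le> part z x u) \<and>
       (part z y q = 0 \<or> (\<forall>u\<in>dirs - {p, q}. part z y u = part z x u)))"
  using assms(4,6)
proof (induction "nat (dist1 z x - part z x p)" arbitrary: x)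
  case 0
  then have "part z x p = dist1 z x" using part_le_dist1[OF assms(1), of z x] by simp
  then have "x = shift z p (dist1 z x)" using tip_iff[of x z p] 0 assms by simp
  then show ?case using 0 by (intro exI[of _ "[x]"]) auto
next
  case (Suc n)
  have "part z x p \<noteq> dist1 z x" using Suc(2) by auto
  then obtain u where u: "u \<in> dirs" "u \<noteq> p" "1 \<le> part z x u" "0 < part z x q \<longrightarrow> u = q"
    using other_direction[OF assms(1-3)] by blast
  define x1 where "x1 = shift x u (-1)"
  define x2 where "x2 = shift x1 p 1"
  have p1: "part z x1 v = part z x v - (if v = u then 1 else 0)" if "v \<in> dirs" for v
    unfolding x1_def using that u by (simp add: part_shift_down)
  have o1: "part z x1 (opp p) = 0"
    using p1[of "opp p"] Suc(4) assms(1) u part_nonneg[of z x1 "opp p"] by (auto split: if_splits)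
  have p2: "part z x2 v = part z x1 v + (if v = p then 1 else 0)" if "v \<in> dirs" for v
    unfolding x2_def using that o1 assms by (simp add: part_shift_up)
  have d1: "dist1 z x1 = dist1 z x - 1" unfolding x1_def using u by (simp add: dist1_shift_down)
  have d2: "dist1 z x2 = dist1 z x"
    unfolding x2_def using d1 o1 assms by (simp add: dist1_shift_up)
  have L: "x1 \<in> L" "x2 \<in> L" using Suc(3) u assms unfolding x1_def x2_def by auto
  have o2: "part z x2 (opp p) = 0"
    using p2[of "opp p"] o1 assms(1) opp_neq[OF assms(1)] by simp
  have "n = nat (dist1 z x2 - part z x2 p)"
    using Suc(2) d2 p2[OF assms(1)] p1[OF assms(1)] u by simp
  from Suc(1)[OF this L(2) o2] obtain W where W: "walk W" "hd W = x2"
    "last W = shift z p (dist1 z x2)"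
    and Wy: "\<And>y. y \<in> set W \<Longrightarrow> dist1 z x2 - 1 \<le> dist1 z y \<and> dist1 z y \<le> dist1 z x2 \<and>
       part z x2 p \<le> part z y p \<and> (\<forall>u\<in>dirs - {p}. part z y u \<le> part z x2 u) \<and>
       (part z y q = 0 \<or> (\<forall>u\<in>dirs - {p, q}. part z y u = part z x2 u))" by blast
  have w1: "walk (x1 # W)"
    by (rule walk_Cons) (use W L assms(1) adj_shift[of p x1 0 1] in \<open>auto simp: x2_def\<close>)
  have w: "walk (x # x1 # W)"
    by (rule walk_Cons) (use w1 Suc(3) u(1) adj_shift[of u x 0 "-1"] in \<open>auto simp: x1_def\<close>)
  have px2: "part z x p < part z x2 p" using p2[OF assms(1)] p1[OF assms(1)] u by simp
  have ox2: "part z x2 v \<le> part z x v" if "v \<in> dirs - {p}" for v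
    using p2[of v] p1[of v] that by simp
  have eq2: "part z x2 v = part z x v" if "v \<in> dirs - {p, q}" "0 < part z x q" for v
    using p2[of v] p1[of v] that u by auto
  have q0: "part z y q = 0" if "y \<in> set W" "part z x q = 0" for y
    using Wy[OF that(1)] ox2[of q] assms that part_nonneg[of z y q] part_nonneg[of z x2 q]
    by (metis DiffI antisym order_trans singletonD)
  have "\<forall>y\<in>set (x # x1 # W). dist1 z x - 1 \<le> dist1 z y \<and> dist1 z y \<le> dist1 z x \<and>
       part z x p \<le> part z y p \<and> (\<forall>u\<in>dirs - {p}. part z y u \<le> part z x u) \<and>
       (part z y q = 0 \<or> (\<forall>u\<in>dirs - {p, q}. part z y u = part z x u))"
  proof
    fix y assume "y \<in> set (x # x1 # W)"
    then consider "y = x" | "y = x1" | "y \<in> set W" by auto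
    then show "dist1 z x - 1 \<le> dist1 z y \<and> dist1 z y \<le> dist1 z x \<and>
       part z x p \<le> part z y p \<and> (\<forall>u\<in>dirs - {p}. part z y u \<le> part z x u) \<and>
       (part z y q = 0 \<or> (\<forall>u\<in>dirs - {p, q}. part z y u = part z x u))"
    proof cases
      case 2
      have "part z x1 q = 0 \<or> (\<forall>u\<in>dirs - {p, q}. part z x1 u = part z x u)"
      proof (cases "0 < part z x q")
        case True
        then show ?thesis using p1 u by auto
      next
        case False
        then have "part z x q = 0" by (simp add: order_antisym)
        then show ?thesis using p1[OF assms(2)] part_nonneg[of z x1 q] by (auto split: if_splits)
      qed
      then show ?thesis using 2 d1 p1 u assms(1) by auto
    next
      case 3
      have "part z y q = 0 \<or> (\<forall>u\<in>dirs - {p, q}. part z y u = part z x u)"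
      proof (cases "0 < part z x q")
        case True
        then show ?thesis using Wy[OF 3] eq2 by metis
      next
        case False
        then have "part z x q = 0" by (simp add: order_antisym)
        then show ?thesis using q0 3 by blast
      qed
      moreover have "\<forall>u\<in>dirs - {p}. part z y u \<le> part z x u"
        using Wy[OF 3] ox2 by (meson order_trans)
      ultimately show ?thesis using Wy[OF 3] d2 px2 by auto
    qed auto
  qed
  moreover have "last (x # x1 # W) = shift z p (dist1 z x)"
    using W d2 by (auto simp: walk_def)
  ultimately show ?case using w by (intro exI[of _ "x # x1 # W"]) auto
qed

text \<open>
  The part of the ball reserved for the path that enters at \<open>a\<close>: the zigzag to the \<open>p\<close>-axis near
  the sphere, and the axis itself.
\<close>

definition arm :: "point \<Rightarrow> int \<Rightarrow> point \<Rightarrow> dir \<Rightarrow> dir \<Rightarrow> point set" where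
  "arm z C a p q =
     {y \<in> L. C - 2 \<le> dist1 z y \<and> part z a p \<le> part z y p \<and>
        (\<forall>u\<in>dirs - {p}. part z y u \<le> part z a u) \<and>
        (part z y q = 0 \<or> (\<forall>u\<in>dirs - {p, q}. part z y u = part z a u))}
     \<union> {shift z p s |s. 1 \<le> s}"

lemma arm_walk:
  assumes "z \<in> L" "a \<in> L" "dist1 z a = C" "2 \<le> C" "p \<in> dirs" "q \<in> dirs" "p \<noteq> q"
    "1 \<le> part z a p"
  shows "\<exists>W. walk (a # W) \<and> W \<noteq> [] \<and> last W = shift z p 1 \<and> set (a # W) \<subseteq> arm z C a p q \<and>
     (\<forall>y\<in>set W. dist1 z y \<le> C - 1)"
proof -
  obtain V where V: "walk V" "hd V = shift z p (C - 1)" "last V = shift z p 1"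
     "set V \<subseteq> {shift z p s |s. 1 \<le> s \<and> s \<le> C - 1}"
    using axis_walk[OF assms(5,1), of 1 "C - 1"] assms(4) by auto
  have Vd: "\<forall>y\<in>set V. dist1 z y \<le> C - 1" using V(4) assms(5) by fastforce
  have Va: "set V \<subseteq> arm z C a p q" using V(4) unfolding arm_def by blast
  have aa: "a \<in> arm z C a p q" using assms unfolding arm_def by auto
  have Vne: "V \<noteq> []" using V(1) by (simp add: walk_def)
  show ?thesis
  proof (cases "part z a p = C")
    case True
    then have a: "a = shift z p C" using tip_iff[OF assms(2,1,5)] assms(3) by simp
    have "walk (a # V)"
      by (rule walk_Cons) (use V a assms(1,2,5) in \<open>auto intro!: adj_shift\<close>)
    then show ?thesis using Vne V(3) Vd Va aa by (intro exI[of _ V]) auto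
  next
    case False
    obtain u where u: "u \<in> dirs" "u \<noteq> p" "1 \<le> part z a u" "0 < part z a q \<longrightarrow> u = q"
      using other_direction[OF assms(5-7), of z a] False assms(3) by blast
    define x where "x = shift a u (-1)"
    have px: "part z x v = part z a v - (if v = u then 1 else 0)" if "v \<in> dirs" for v
      unfolding x_def using that u by (simp add: part_shift_down)
    have dx: "dist1 z x = C - 1" unfolding x_def using u assms(3) by (simp add: dist1_shift_down)
    have "part z x (opp p) = 0"
      using px[of "opp p"] part_opp[of z a p] assms(5,8) part_nonneg[of z x "opp p"]
      by (auto split: if_splits)
    moreover have xL: "x \<in> L" unfolding x_def using u assms(2) by simp
    ultimately obtain Y where Y: "walk Y" "hd Y = x" "last Y = shift z p (dist1 z x)"
      and Yy: "\<And>y. y \<in> set Y \<Longrightarrow> dist1 z x - 1 \<le> dist1 z y \<and> dist1 z y \<le> dist1 z x \<and>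
       part z x p \<le> part z y p \<and> (\<forall>u\<in>dirs - {p}. part z y u \<le> part z x u) \<and>
       (part z y q = 0 \<or> (\<forall>u\<in>dirs - {p, q}. part z y u = part z x u))"
      using zigzag[OF assms(5,6,7) xL assms(1)] by blast
    have "last Y = hd V" using Y V dx by simp
    note J = walk_join[OF Y(1) V(1) this]
    have "walk (a # (Y @ tl V))"
      by (rule walk_Cons) (use J Y(2) assms(2) u(1) adj_shift[of u a 0 "-1"] in \<open>auto simp: x_def\<close>)
    moreover have "set Y \<subseteq> arm z C a p q"
    proof
      fix y assume y: "y \<in> set Y"
      then have "y \<in> L" using Y(1) by (auto simp: walk_def)
      moreover have "part z a p \<le> part z y p" using Yy[OF y] px[OF assms(5)] u by simp
      moreover have "\<forall>u\<in>dirs - {p}. part z y u \<le> part z a u"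
      proof
        fix v assume v: "v \<in> dirs - {p}"
        then have "part z y v \<le> part z x v" using Yy[OF y] by blast
        also have "\<dots> \<le> part z a v" using px[of v] v by auto
        finally show "part z y v \<le> part z a v" .
      qed
      moreover have "part z y q = 0 \<or> (\<forall>u\<in>dirs - {p, q}. part z y u = part z a u)"
      proof (cases "0 < part z a q")
        case True
        then show ?thesis using Yy[OF y] px u by auto
      next
        case False
        then have "part z a q = 0" by (simp add: order_antisym)
        then show ?thesis using \<open>\<forall>u\<in>dirs - {p}. part z y u \<le> part z a u\<close> assms(6,7)
            part_nonneg[of z y q] by (metis DiffI antisym singletonD)
      qed
      ultimately show "y \<in> arm z C a p q" using Yy[OF y] dx unfolding arm_def by auto
    qed
    moreover have "\<forall>y\<in>set Y. dist1 z y \<le> C - 1" using Yy dx by auto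
    moreover have "Y @ tl V \<noteq> []" using Y(1) by (simp add: walk_def)
    ultimately show ?thesis using J V(3) Vd Va aa by (intro exI[of _ "Y @ tl V"]) auto
  qed
qed

lemma dist1_two:
  assumes "p \<in> dirs" "q \<in> dirs" "p \<noteq> q"
  shows "\<bar>part z x p - part z y p\<bar> + \<bar>part z x q - part z y q\<bar> \<le> dist1 x y"
proof -
  have "(\<Sum>u\<in>{p, q}. \<bar>part z x u - part z y u\<bar>) \<le> dist1 x y"
    unfolding dist1_part[of x y z] by (rule sum_mono2) (use assms in auto)
  then show ?thesis using assms by simp
qed

text \<open>
  A point of the zigzag starting at \<open>b\<close> that is next to the \<open>p\<close>-axis consists of units of \<open>p\<close> and a
  single unit of \<open>q\<close>.  Since units of \<open>p\<close> are given up before all others, \<open>b\<close> itself then has this form,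
  and \<open>a\<close>, which reaches further in direction \<open>p\<close>, can only be the tip: the pair is bad.
\<close>

lemma axis_slice_apart:
  assumes "z \<in> L" "a \<in> L" "b \<in> L" "dist1 z a = C" "dist1 z b = C"
    and pq: "p \<in> dirs" "q \<in> dirs" "p \<noteq> q"
    and "part z b p < part z a p" "part z a q < part z b q"
    and nb: "\<not> (a = shift z p C \<and> adj b (shift z p (C - 1)))"
    and s: "1 \<le> s" and yL: "y \<in> L" and y: "part z b q \<le> part z y q"
      "part z y p = 0 \<or> (\<forall>u\<in>dirs - {q, p}. part z y u = part z b u)"
      "part z y p \<le> part z b p"
  shows "2 \<le> dist1 (shift z p s) y"
proof (rule ccontr)
  assume "\<not> ?thesis"
  then have le: "dist1 (shift z p s) y \<le> 1" by simp
  have sp: "part z (shift z p s) u = (if u = p then s else 0)" if "u \<in> dirs" for u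
    using part_shift_centre[of p u s z] that pq s by simp
  have bq: "1 \<le> part z b q" using assms(10) part_nonneg[of z a q] by linarith
  have dec: "dist1 (shift z p s) y = \<bar>part z (shift z p s) q - part z y q\<bar> +
     (\<Sum>u\<in>dirs - {q}. \<bar>part z (shift z p s) u - part z y u\<bar>)"
    unfolding dist1_part[of _ _ z] using pq(2) by (subst sum.remove[of _ q]) auto
  have nn: "0 \<le> (\<Sum>u\<in>dirs - {q}. \<bar>part z (shift z p s) u - part z y u\<bar>)"
    by (rule sum_nonneg) auto
  have "part z (shift z p s) q = 0" using sp[OF pq(2)] pq(3) by simp
  note dec' = dec[unfolded this]
  have yq: "part z y q = 1" using dec' nn le y(1) bq by linarith
  have "(\<Sum>u\<in>dirs - {q}. \<bar>part z (shift z p s) u - part z y u\<bar>) = 0"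
    using dec' nn le y(1) bq by linarith
  then have eq: "part z y u = (if u = p then s else 0)" if "u \<in> dirs - {q}" for u
    using that sp[of u] by (subst (asm) sum_nonneg_eq_0_iff) auto
  have yp: "part z y p = s" using eq[of p] pq by simp
  then have bu: "part z b u = 0" if "u \<in> dirs - {q, p}" for u
    using y(2) s eq[of u] that by auto
  have bq1: "part z b q = 1" using bq y(1) yq by simp
  have "dist1 z b = part z b q + (part z b p + (\<Sum>u\<in>dirs - {q} - {p}. part z b u))"
    unfolding dist1_centre using pq
    by (subst sum.remove[of _ q], simp, simp, subst sum.remove[of _ p]) auto
  also have "(\<Sum>u\<in>dirs - {q} - {p}. part z b u) = 0" using bu by (intro sum.neutral) auto
  finally have bp: "part z b p = C - 1" using assms(5) bq1 by simp
  then have "part z a p = C" using assms(9) part_le_dist1[OF pq(1), of z a] assms(4) by simp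
  then have aC: "a = shift z p C" using tip_iff[OF assms(2,1) pq(1)] assms(4) by simp
  have C1: "1 \<le> C" using bp y(3) yp s by simp
  have "dist1 b (shift z p (C - 1)) = (\<Sum>u\<in>dirs. if u = q then 1 else 0)"
    unfolding dist1_part[of _ _ z]
  proof (rule sum.cong)
    fix u assume u: "u \<in> dirs"
    have "part z (shift z p (C - 1)) u = (if u = p then C - 1 else 0)"
      using part_shift_centre[of p u "C - 1" z] u pq C1 by simp
    then show "\<bar>part z b u - part z (shift z p (C - 1)) u\<bar> = (if u = q then 1 else 0)"
      using bu[of u] bp bq1 u pq by auto
  qed simp
  then have "adj b (shift z p (C - 1))" using pq assms by (simp add: adj_iff)
  then show False using nb aC by blast
qed

text \<open>
  On the zigzags red exceeds green in direction \<open>p\<close> and green exceeds red in direction \<open>q\<close>, each by at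
  least one.
\<close>

lemma arms_apart:
  assumes "z \<in> L" "a \<in> L" "b \<in> L" "dist1 z a = C" "dist1 z b = C"
    and pq: "p \<in> dirs" "q \<in> dirs" "p \<noteq> q"
    and gt: "part z b p < part z a p" "part z a q < part z b q"
    and nb: "\<And>w. w \<in> dirs \<Longrightarrow> \<not> bad_pair d z C w a b"
    and x: "x \<in> arm z C a p q" and y: "y \<in> arm z C b q p"
  shows "2 \<le> dist1 x y"
proof -
  have nb1: "\<not> (a = shift z p C \<and> adj b (shift z p (C - 1)))"
    and nb2: "\<not> (b = shift z q C \<and> adj a (shift z q (C - 1)))"
    using nb[OF pq(1)] nb[OF pq(2)] unfolding bad_pair_def by auto
  consider s t where "x = shift z p s" "1 \<le> s" "y = shift z q t" "1 \<le> t"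
    | s where "x = shift z p s" "1 \<le> s" "y \<in> L" "part z b q \<le> part z y q"
        "\<forall>u\<in>dirs - {q}. part z y u \<le> part z b u"
        "part z y p = 0 \<or> (\<forall>u\<in>dirs - {q, p}. part z y u = part z b u)"
    | t where "y = shift z q t" "1 \<le> t" "x \<in> L" "part z a p \<le> part z x p"
        "\<forall>u\<in>dirs - {p}. part z x u \<le> part z a u"
        "part z x q = 0 \<or> (\<forall>u\<in>dirs - {p, q}. part z x u = part z a u)"
    | "part z a p \<le> part z x p" "part z b q \<le> part z y q"
        "part z y p \<le> part z b p" "part z x q \<le> part z a q"
    using x y pq unfolding arm_def by auto
  then show ?thesis
  proof cases
    case 1
    then show ?thesis
      using dist1_two[OF pq, of z x y] part_shift_centre[of p p s z] part_shift_centre[of p q s z]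
        part_shift_centre[of q p t z] part_shift_centre[of q q t z] pq by simp
  next
    case 2
    then show ?thesis
      using axis_slice_apart[OF assms(1-5) pq gt nb1] pq by auto
  next
    case 3
    then have "2 \<le> dist1 (shift z q t) x"
      using axis_slice_apart[OF assms(1,3,2,5,4) pq(2,1) pq(3)[symmetric] gt(2,1) nb2] pq by auto
    then show ?thesis using 3 dist1_commute by simp
  next
    case 4
    then show ?thesis using dist1_two[OF pq, of z x y] gt by linarith
  qed
qed

lemma directions_exist:
  assumes "a \<in> L" "b \<in> L" "dist1 z a = dist1 z b" "a \<noteq> b"
  shows "\<exists>p\<in>dirs. part z b p < part z a p"
proof (rule ccontr)
  assume "\<not> ?thesis"
  then have le: "\<And>u. u \<in> dirs \<Longrightarrow> part z a u \<le> part z b u" by (meson not_le)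
  have "(\<Sum>u\<in>dirs. part z b u - part z a u) = 0"
    using assms(3) by (simp add: sum_subtractf dist1_centre)
  then have "\<forall>u\<in>dirs. part z b u - part z a u = 0"
    using le by (subst (asm) sum_nonneg_eq_0_iff) auto
  then have "a = b" by (intro point_eqI[of _ _ z]) (use assms in auto)
  then show False using assms(4) by simp
qed

end

section \<open>Continuing two walks through a ball\<close>

context grid begin

abbreviation apart :: "point list \<Rightarrow> point list \<Rightarrow> bool" where
  "apart \<equiv> no_red_green_adjacent d"

text \<open>
  Only vertices, not their order, matter for red-green adjacency, so walks are extended freely and
  repetitions are removed at the very end (\<open>walk_shortcut\<close>).
\<close>

definition arrives :: "point set \<Rightarrow> point \<Rightarrow> point list \<Rightarrow> bool" where
  "arrives X a P \<longleftrightarrow> walk P \<and> last P = a \<and> a \<in> X \<and> set (butlast P) \<inter> X = {}"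

lemma arrives_cases: "arrives X a P \<Longrightarrow> x \<in> set P \<Longrightarrow> x = a \<or> x \<notin> X"
proof -
  assume a: "arrives X a P" "x \<in> set P"
  then have "P \<noteq> []" by auto
  then have "set P = set (butlast P @ [last P])" by (subst append_butlast_last_id) auto
  then show ?thesis using a by (auto simp: arrives_def)
qed

lemma arrives_extend:
  assumes "walk P" "set P \<inter> X = {}" "walk (last P # W)" "W \<noteq> []" "last W \<in> X"
  shows "\<exists>V a. arrives X a V \<and> hd V = hd P \<and> set V \<subseteq> set P \<union> set W \<and> a \<in> set W"
proof -
  have "\<exists>x\<in>set W. x \<in> X" using assms(4,5) last_in_set by blast
  then obtain ys x zs where W: "W = ys @ x # zs" "x \<in> X" "\<forall>y\<in>set ys. y \<notin> X"
    using split_list_first_prop[of W "\<lambda>x. x \<in> X"] by blast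
  have "successively adj ((last P # ys @ [x]) @ zs)" using assms(3) W(1) by (simp add: walk_def)
  then have s: "successively adj (last P # ys @ [x])"
    by (simp only: successively_append_iff)
  have "set (ys @ [x]) \<subseteq> L" using assms(3) W(1) by (simp add: walk_def)
  moreover have "successively adj (ys @ [x])" using s by (simp only: successively_Cons) simp
  ultimately have "walk (ys @ [x])" by (simp add: walk_def)
  moreover have "adj (last P) (hd (ys @ [x]))" using s by (cases ys) auto
  ultimately have "walk (P @ ys @ [x])" using walk_append assms(1) by blast
  moreover have "P \<noteq> []" using assms(1) by (simp add: walk_def)
  ultimately have "arrives X x (P @ ys @ [x])"
    using assms(2) W unfolding arrives_def by (auto simp: butlast_append)
  then show ?thesis using W \<open>P \<noteq> []\<close> by (intro exI[of _ "P @ ys @ [x]"] exI[of _ x]) auto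
qed

lemma arrives_dist:
  assumes "arrives (ball1 z C) a P" "hd P \<notin> ball1 z C"
  shows "dist1 z a = C"
proof -
  have P: "walk P" "last P = a" "a \<in> ball1 z C" "set (butlast P) \<inter> ball1 z C = {}"
    using assms by (auto simp: arrives_def)
  then have "P = butlast P @ [a]" by (metis append_butlast_last_id walk_def)
  moreover have "butlast P \<noteq> []" using calculation assms(2) P(3) by (cases "butlast P") auto
  ultimately obtain ys y where "P = ys @ [y, a]" and y: "y \<in> set (butlast P)"
    by (metis append_Cons append_Nil append_assoc append_butlast_last_id last_in_set)
  then have "adj y a" "y \<in> L" using P(1) by (auto simp: walk_def successively_append_iff)
  moreover have "C < dist1 z y" using P(4) y calculation by (auto simp: ball1_def)
  ultimately have "C < dist1 z a + 1" using dist1_triangle[of z y a] dist1_commute[of a y]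
    by (simp add: adj_iff)
  then show ?thesis using P(3) by (auto simp: ball1_def)
qed

lemma not_adj_far: "C < dist1 z x \<Longrightarrow> dist1 z y \<le> C - 1 \<Longrightarrow> \<not> adj x y"
  using dist1_triangle[of z x y] by (auto simp: adj_iff dist1_commute)

text \<open>
  The central step: from entries into a ball that are not bad, both walks continue along their arms
  until they first meet a set \<open>X\<close> surrounding the centre.  Later arguments need to know that the
  new entries lie on arms that are far apart.
\<close>

lemma transition:
  assumes zL: "z \<in> L" and P: "arrives (ball1 z C) a P" and Q: "arrives (ball1 z C) b Q"
    and da: "dist1 z a = C" and db: "dist1 z b = C" and C: "2 \<le> C" and PQ: "apart P Q"
    and ab: "a \<noteq> b" and nb: "\<And>w. w \<in> dirs \<Longrightarrow> \<not> bad_pair d z C w a b"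
    and PX: "set P \<inter> X = {}" and QX: "set Q \<inter> X = {}"
    and X: "\<And>u. u \<in> dirs \<Longrightarrow> shift z u 1 \<in> X"
  obtains p q P' Q' a' b' where "p \<in> dirs" "q \<in> dirs" "p \<noteq> q" "1 \<le> part z a p" "1 \<le> part z b q"
    "arrives X a' P'" "arrives X b' Q'" "apart P' Q'" "hd P' = hd P" "hd Q' = hd Q"
    "set P' \<subseteq> set P \<union> ball1 z (C - 1)" "set Q' \<subseteq> set Q \<union> ball1 z (C - 1)"
    "a' \<in> arm z C a p q" "b' \<in> arm z C b q p"
    "\<And>x y. x \<in> arm z C a p q \<Longrightarrow> y \<in> arm z C b q p \<Longrightarrow> 2 \<le> dist1 x y"
proof -
  have aL: "a \<in> L" and bL: "b \<in> L" using P Q by (auto simp: arrives_def ball1_def)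
  obtain p where p: "p \<in> dirs" "part z b p < part z a p"
    using directions_exist[OF aL bL _ ab, of z] da db by auto
  obtain q where q: "q \<in> dirs" "part z a q < part z b q"
    using directions_exist[OF bL aL _ ab[symmetric], of z] da db by auto
  have pq: "p \<noteq> q" using p q by auto
  have ap: "1 \<le> part z a p" "1 \<le> part z b q"
    using p q part_nonneg[of z b p] part_nonneg[of z a q] by linarith+
  have far: "2 \<le> dist1 x y" if "x \<in> arm z C a p q" "y \<in> arm z C b q p" for x y
    using arms_apart[OF zL aL bL da db p(1) q(1) pq p(2) q(2) _ that] nb by blast
  obtain V where V: "walk (a # V)" "V \<noteq> []" "last V = shift z p 1"
    "set (a # V) \<subseteq> arm z C a p q" "\<forall>y\<in>set V. dist1 z y \<le> C - 1"
    using arm_walk[OF zL aL da C p(1) q(1) pq ap(1)] by blast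
  obtain W where W: "walk (b # W)" "W \<noteq> []" "last W = shift z q 1"
    "set (b # W) \<subseteq> arm z C b q p" "\<forall>y\<in>set W. dist1 z y \<le> C - 1"
    using arm_walk[OF zL bL db C q(1) p(1) pq[symmetric] ap(2)] by blast
  have PP: "walk P" "last P = a" and QQ: "walk Q" "last Q = b"
    using P Q by (auto simp: arrives_def)
  obtain P' a' where P': "arrives X a' P'" "hd P' = hd P" "set P' \<subseteq> set P \<union> set V" "a' \<in> set V"
    using arrives_extend[OF PP(1) PX, of V] V X[OF p(1)] PP(2) by auto
  obtain Q' b' where Q': "arrives X b' Q'" "hd Q' = hd Q" "set Q' \<subseteq> set Q \<union> set W" "b' \<in> set W"
    using arrives_extend[OF QQ(1) QX, of W] W X[OF q(1)] QQ(2) by auto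
  have VL: "set V \<subseteq> L" "set W \<subseteq> L" using V(1) W(1) by (auto simp: walk_def)
  have "apart P' Q'"
    unfolding no_red_green_adjacent_def
  proof (intro ballI)
    fix x y assume "x \<in> set P'" "y \<in> set Q'"
    then consider "x \<in> set P" "y \<in> set Q" | "x \<in> set P" "y \<in> set W"
      | "x \<in> set V" "y \<in> set Q" | "x \<in> set V" "y \<in> set W" using P'(3) Q'(3) by auto
    then show "\<not> adj x y"
    proof cases
      case 1
      then show ?thesis using PQ by (auto simp: no_red_green_adjacent_def)
    next
      case 2
      then consider "x = a" | "x \<notin> ball1 z C" using arrives_cases[OF P] by blast
      then show ?thesis
      proof cases
        case 1
        then show ?thesis using far[of x y] V(4) W(4) 2 by (auto simp: adj_iff)
      next
        case 2: 2
        have "x \<in> L" using \<open>x \<in> set P\<close> PP by (auto simp: walk_def)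
        then show ?thesis using not_adj_far[of C z x y] 2 W(5) \<open>y \<in> set W\<close>
          by (auto simp: ball1_def)
      qed
    next
      case 3
      then consider "y = b" | "y \<notin> ball1 z C" using arrives_cases[OF Q] by blast
      then show ?thesis
      proof cases
        case 1
        then show ?thesis using far[of x y] V(4) W(4) 3 by (auto simp: adj_iff)
      next
        case 2
        have "y \<in> L" using \<open>y \<in> set Q\<close> QQ by (auto simp: walk_def)
        then show ?thesis using not_adj_far[of C z y x] 2 V(5) \<open>x \<in> set V\<close> adj_commute
          by (auto simp: ball1_def)
      qed
    next
      case 4
      then have "x \<in> arm z C a p q" "y \<in> arm z C b q p" using V(4) W(4) by auto
      then have "2 \<le> dist1 x y" by (rule far)
      then show ?thesis by (simp add: adj_iff)
    qed
  qed
  moreover have "set P' \<subseteq> set P \<union> ball1 z (C - 1)" "set Q' \<subseteq> set Q \<union> ball1 z (C - 1)"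
    using P'(3) Q'(3) V(5) W(5) VL by (auto simp: ball1_def)
  moreover have "a' \<in> arm z C a p q" "b' \<in> arm z C b q p" using P'(4) Q'(4) V(4) W(4) by auto
  ultimately show ?thesis
    using that[OF p(1) q(1) pq ap P'(1) Q'(1) _ P'(2) Q'(2)] far by blast
qed

lemma origin_L [simp]: "origin \<in> L"
  by (simp add: lattice_def origin_def)

text \<open>
  Once a walk sits on an axis it can turn to another axis at almost constant distance from the
  origin, and then go straight in.  The support condition keeps two such walks apart.
\<close>

lemma turn:
  assumes "p \<in> dirs" "f \<in> dirs" "p \<noteq> opp f" "1 \<le> m" "m \<le> N" "N + 3 \<le> k"
  shows "\<exists>W. walk (shift origin p k # W) \<and> W \<noteq> [] \<and> last W = shift origin f m \<and>
    (\<forall>y\<in>set W. y \<in> L \<and> 1 \<le> dist1 origin y \<and> dist1 origin y \<le> k - 1 \<and>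
       (\<forall>u\<in>dirs - {p, f}. part origin y u = 0) \<and>
       (N < dist1 origin y \<or> (\<exists>t\<ge>m. y = shift origin f t)))"
proof -
  define x where "x = shift origin p (k - 1)"
  have xL: "x \<in> L" unfolding x_def using assms by simp
  have px: "part origin x u = (if u = p then k - 1 else 0)" if "u \<in> dirs" for u
    unfolding x_def using part_shift_centre[of p u "k - 1" origin] that assms by simp
  have dx: "dist1 origin x = k - 1" unfolding x_def using assms by simp
  have "part origin x (opp f) = 0" using px[of "opp f"] assms by auto
  from zigzag[OF assms(2) _ opp_neq[OF assms(2), symmetric] xL origin_L this] assms(2)
  obtain Y where Y: "walk Y" "hd Y = x" "last Y = shift origin f (k - 1)"
    and Yy: "\<And>y. y \<in> set Y \<Longrightarrow> k - 2 \<le> dist1 origin y \<and> dist1 origin y \<le> k - 1 \<and>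
        (\<forall>u\<in>dirs - {f}. part origin y u \<le> part origin x u)"
    using dx by auto
  obtain V where V: "walk V" "hd V = shift origin f (k - 1)" "last V = shift origin f m"
     "set V \<subseteq> {shift origin f s |s. m \<le> s \<and> s \<le> k - 1}"
    using axis_walk[OF assms(2) origin_L, of m "k - 1"] assms by auto
  have "last Y = hd V" using Y V by simp
  note J = walk_join[OF Y(1) V(1) this]
  have "walk (shift origin p k # (Y @ tl V))"
    by (rule walk_Cons) (use J Y(2) assms in \<open>auto simp: x_def intro!: adj_shift\<close>)
  moreover have "Y @ tl V \<noteq> []" using Y(1) by (simp add: walk_def)
  moreover have "\<forall>y\<in>set (Y @ tl V). y \<in> L \<and> 1 \<le> dist1 origin y \<and> dist1 origin y \<le> k - 1 \<and>
       (\<forall>u\<in>dirs - {p, f}. part origin y u = 0) \<and>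
       (N < dist1 origin y \<or> (\<exists>t\<ge>m. y = shift origin f t))"
  proof
    fix y assume "y \<in> set (Y @ tl V)"
    then consider "y \<in> set Y" | "y \<in> set V" using J(4) by blast
    then show "y \<in> L \<and> 1 \<le> dist1 origin y \<and> dist1 origin y \<le> k - 1 \<and>
       (\<forall>u\<in>dirs - {p, f}. part origin y u = 0) \<and>
       (N < dist1 origin y \<or> (\<exists>t\<ge>m. y = shift origin f t))"
    proof cases
      case 1
      have "part origin y u = 0" if "u \<in> dirs - {p, f}" for u
        using Yy[OF 1] px[of u] that part_nonneg[of origin y u]
        by (metis DiffE insertCI order_antisym DiffI singletonD)
      then show ?thesis using Yy[OF 1] assms Y(1) 1 by (auto simp: walk_def)
    next
      case 2
      then obtain s where s: "y = shift origin f s" "m \<le> s" "s \<le> k - 1" using V(4) by auto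
      then show ?thesis using assms part_shift_centre[of f _ s origin] by auto
    qed
  qed
  ultimately show ?thesis using J V(3) by (intro exI[of _ "Y @ tl V"]) auto
qed

lemma disjoint_support:
  assumes "\<And>u. u \<in> dirs \<Longrightarrow> part z x u = 0 \<or> part z y u = 0"
  shows "dist1 x y = dist1 z x + dist1 z y"
proof -
  have "dist1 x y = (\<Sum>u\<in>dirs. part z x u + part z y u)"
    unfolding dist1_part[of x y z] by (rule sum.cong) (use assms in fastforce)+
  then show ?thesis by (simp add: sum.distrib dist1_centre)
qed

definition finished :: "int \<Rightarrow> int \<Rightarrow> point set \<Rightarrow> point list \<Rightarrow> point list \<Rightarrow> bool" where
  "finished m N Y P Q \<longleftrightarrow> (\<exists>f P' Q'. f \<in> dirs \<and> fst f = 0 \<and> walk P' \<and> walk Q' \<and>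
     hd P' = hd P \<and> hd Q' = hd Q \<and> apart P' Q' \<and>
     last P' = shift origin f m \<and> last Q' = shift origin (opp f) m \<and>
     set P' \<subseteq> set P \<union> Y \<and> set Q' \<subseteq> set Q \<union> Y \<and>
     (\<forall>x\<in>set P'. N < dist1 origin x \<or> (\<exists>t\<ge>m. x = shift origin f t)) \<and>
     (\<forall>x\<in>set Q'. N < dist1 origin x \<or> (\<exists>t\<ge>m. x = shift origin (opp f) t)))"

text \<open>
  The target axis direction \<open>f\<close> for red is chosen so that neither walk has to pass through the other
  one's half-axis: \<open>{p, f}\<close> and \<open>{q, opp f}\<close> are disjoint, and so are the supports of the walks.
\<close>

lemma finish:
  assumes P: "arrives (ball1 origin k) (shift origin p k) P"
    and Q: "arrives (ball1 origin k) (shift origin q k) Q"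
    and pq: "p \<in> dirs" "q \<in> dirs" "p \<noteq> q" and PQ: "apart P Q"
    and m: "1 \<le> m" "m \<le> N" "N + 3 \<le> k"
  shows "finished m N (ball1 origin k) P Q"
proof -
  define e :: dir where "e = (0, 1)"
  have e: "e \<in> dirs" using two_le_d by (auto simp: e_def dirs_def)
  have "\<exists>f\<in>{e, opp e}. p \<noteq> opp f \<and> q \<noteq> f"
    using pq(3) opp_neq[OF e] by auto
  then obtain f where f: "f \<in> {e, opp e}" "p \<noteq> opp f" "q \<noteq> f" by blast
  have fd: "f \<in> dirs" "fst f = 0" using f(1) e two_le_d by (auto simp: e_def opp_def dirs_def)
  obtain V where V: "walk (shift origin p k # V)" "V \<noteq> []" "last V = shift origin f m"
    and Vy: "\<And>y. y \<in> set V \<Longrightarrow> y \<in> L \<and> 1 \<le> dist1 origin y \<and> dist1 origin y \<le> k - 1 \<and>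
       (\<forall>u\<in>dirs - {p, f}. part origin y u = 0) \<and>
       (N < dist1 origin y \<or> (\<exists>t\<ge>m. y = shift origin f t))"
    using turn[OF pq(1) fd(1) f(2) m] by blast
  have "q \<noteq> opp (opp f)" using f(3) by simp
  then obtain W where W: "walk (shift origin q k # W)" "W \<noteq> []" "last W = shift origin (opp f) m"
    and Wy: "\<And>y. y \<in> set W \<Longrightarrow> y \<in> L \<and> 1 \<le> dist1 origin y \<and> dist1 origin y \<le> k - 1 \<and>
       (\<forall>u\<in>dirs - {q, opp f}. part origin y u = 0) \<and>
       (N < dist1 origin y \<or> (\<exists>t\<ge>m. y = shift origin (opp f) t))"
    using turn[OF pq(2) _ _ m, of "opp f"] fd(1) by auto
  have PP: "walk P" "last P = shift origin p k" "P \<noteq> []"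
    and QQ: "walk Q" "last Q = shift origin q k" "Q \<noteq> []"
    using P Q by (auto simp: arrives_def walk_def)
  have walks: "walk (P @ V)" "walk (Q @ W)"
    using PP QQ V W by (auto simp: walk_def successively_append_iff successively_Cons)
  have kp: "part origin (shift origin p k) u = (if u = p then k else 0)"
    and kq: "part origin (shift origin q k) u = (if u = q then k else 0)" if "u \<in> dirs" for u
    using part_shift_centre[of p u k origin] part_shift_centre[of q u k origin] that pq m by auto
  have ne: "p \<noteq> q" "p \<noteq> opp f" "f \<noteq> q" "f \<noteq> opp f"
    using pq f opp_neq[OF fd(1)] by auto
  have far: "\<not> adj x y" if "x \<in> set V \<union> {shift origin p k}" "y \<in> set W \<union> {shift origin q k}" for x y
  proof -
    have x: "1 \<le> dist1 origin x" "\<And>u. u \<in> dirs \<Longrightarrow> u \<noteq> p \<Longrightarrow> u \<noteq> f \<Longrightarrow> part origin x u = 0"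
      using that(1) Vy kp pq m by auto
    have y: "1 \<le> dist1 origin y" "\<And>u. u \<in> dirs \<Longrightarrow> u \<noteq> q \<Longrightarrow> u \<noteq> opp f \<Longrightarrow> part origin y u = 0"
      using that(2) Wy kq pq m by auto
    have "dist1 x y = dist1 origin x + dist1 origin y"
      by (rule disjoint_support) (use x(2) y(2) ne in metis)
    then show ?thesis using x(1) y(1) by (simp add: adj_iff)
  qed
  have "apart (P @ V) (Q @ W)"
    unfolding no_red_green_adjacent_def
  proof (intro ballI)
    fix x y assume "x \<in> set (P @ V)" "y \<in> set (Q @ W)"
    then consider "x \<in> set P" "y \<in> set Q" | "x \<in> set P" "x \<noteq> shift origin p k" "y \<in> set W"
      | "x \<in> set V" "y \<in> set Q" "y \<noteq> shift origin q k"
      | "x \<in> set V \<union> {shift origin p k}" "y \<in> set W \<union> {shift origin q k}" by auto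
    then show "\<not> adj x y"
    proof cases
      case 1
      then show ?thesis using PQ by (auto simp: no_red_green_adjacent_def)
    next
      case 2
      then have "x \<notin> ball1 origin k" "x \<in> L" using arrives_cases[OF P] PP(1) by (auto simp: walk_def)
      then show ?thesis using not_adj_far[of k origin x y] Wy[OF 2(3)] by (auto simp: ball1_def)
    next
      case 3
      then have "y \<notin> ball1 origin k" "y \<in> L" using arrives_cases[OF Q] QQ(1) by (auto simp: walk_def)
      then show ?thesis using not_adj_far[of k origin y x] Vy[OF 3(1)] adj_commute
        by (auto simp: ball1_def)
    next
      case 4
      then show ?thesis by (rule far)
    qed
  qed
  moreover have nP: "N < dist1 origin x" if "x \<in> set P" for x
    using arrives_cases[OF P that] PP(1) that pq m by (auto simp: ball1_def walk_def)
  moreover have nQ: "N < dist1 origin x" if "x \<in> set Q" for x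
    using arrives_cases[OF Q that] QQ(1) that pq m by (auto simp: ball1_def walk_def)
  moreover have "set V \<subseteq> ball1 origin k" "set W \<subseteq> ball1 origin k"
    using Vy Wy unfolding ball1_def by force+
  moreover have "\<forall>x\<in>set (P @ V). N < dist1 origin x \<or> (\<exists>t\<ge>m. x = shift origin f t)"
    using nP Vy by (metis Un_iff set_append)
  moreover have "\<forall>x\<in>set (Q @ W). N < dist1 origin x \<or> (\<exists>t\<ge>m. x = shift origin (opp f) t)"
    using nQ Wy by (metis Un_iff set_append)
  moreover have "hd (P @ V) = hd P" "hd (Q @ W) = hd Q" "last (P @ V) = shift origin f m"
    "last (Q @ W) = shift origin (opp f) m"
    using PP(3) QQ(3) V(2,3) W(2,3) by auto
  moreover have "set (P @ V) \<subseteq> set P \<union> ball1 origin k" "set (Q @ W) \<subseteq> set Q \<union> ball1 origin k"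
    using \<open>set V \<subseteq> ball1 origin k\<close> \<open>set W \<subseteq> ball1 origin k\<close> by auto
  ultimately show ?thesis
    unfolding finished_def
    using fd walks by blast
qed

end

context grid begin

lemma finished_mono:
  assumes "finished m N Y' P' Q'" "hd P' = hd P" "hd Q' = hd Q"
    "set P' \<subseteq> set P \<union> Y" "set Q' \<subseteq> set Q \<union> Y" "Y' \<subseteq> Y"
  shows "finished m N Y P Q"
proof -
  obtain f P2 Q2 where *: "f \<in> dirs" "fst f = 0" "walk P2" "walk Q2"
     "hd P2 = hd P'" "hd Q2 = hd Q'" "apart P2 Q2"
     "last P2 = shift origin f m" "last Q2 = shift origin (opp f) m"
     "set P2 \<subseteq> set P' \<union> Y'" "set Q2 \<subseteq> set Q' \<union> Y'"
     "\<forall>x\<in>set P2. N < dist1 origin x \<or> (\<exists>t\<ge>m. x = shift origin f t)"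
     "\<forall>x\<in>set Q2. N < dist1 origin x \<or> (\<exists>t\<ge>m. x = shift origin (opp f) t)"
    using assms(1) unfolding finished_def by blast
  have "set P2 \<subseteq> set P \<union> Y" "set Q2 \<subseteq> set Q \<union> Y" using *(10,11) assms(4-6) by blast+
  then show ?thesis unfolding finished_def using * assms(2,3) by metis
qed

lemma ball1_subset:
  assumes "dist1 y z + k \<le> l" shows "ball1 z k \<subseteq> ball1 y l"
proof
  fix x assume "x \<in> ball1 z k"
  then show "x \<in> ball1 y l" using dist1_triangle[of y x z] assms by (simp add: ball1_def)
qed

lemma bad_pair_dist:
  assumes "bad_pair d z C w a b" "w \<in> dirs"
  shows "dist1 a b \<le> 2"
proof -
  have "dist1 x y \<le> 2" if "x = shift z w C" "adj y (shift z w (C - 1))" for x y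
  proof -
    have "dist1 x y \<le> dist1 x (shift z w (C - 1)) + dist1 (shift z w (C - 1)) y"
      by (rule dist1_triangle)
    also have "dist1 (shift z w (C - 1)) y = 1"
      using that(2) adj_commute[of y] by (simp add: adj_iff)
    also have "dist1 x (shift z w (C - 1)) = 1" using that(1) assms(2) by (simp add: dist1_shift)
    finally show ?thesis by simp
  qed
  then show ?thesis using assms(1) dist1_commute[of a b] unfolding bad_pair_def by metis
qed

text \<open>
  First pass from the given ball to one about the origin.  The latter is so deep inside that it is
  met on the two axes through \<open>y\<close>, away from \<open>y\<close>, and the entries are too far from each other to be
  bad.  A second passage, now with centre \<open>origin\<close>, brings both walks onto axes through the origin.
\<close>

lemma win_from_ball:
  assumes yL: "y \<in> L" and P: "arrives (ball1 y C) a P" and Q: "arrives (ball1 y C) b Q"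
    and hP: "hd P \<notin> ball1 y C" and hQ: "hd Q \<notin> ball1 y C" and PQ: "apart P Q"
    and ab: "a \<noteq> b" and nb: "\<And>w. w \<in> dirs \<Longrightarrow> \<not> bad_pair d y C w a b"
    and m: "1 \<le> m" "m \<le> N" and C: "2 * dist1 origin y + N + 12 \<le> C"
  shows "finished m N (ball1 y C) P Q"
proof -
  define K where "K = dist1 origin y + N + 8"
  have K: "dist1 origin y + 2 \<le> K" "N + 6 \<le> K" "K + dist1 origin y + 3 \<le> C"
    using C m dist1_nonneg[of origin y] unfolding K_def by linarith+
  have sub: "ball1 origin K \<subseteq> ball1 y (C - 3)"
    by (rule ball1_subset) (use K dist1_commute[of origin y] in simp)
  have da: "dist1 y a = C" and db: "dist1 y b = C"
    using arrives_dist P Q hP hQ by blast+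
  have PX: "set P \<inter> ball1 origin K = {}"
  proof -
    have "x \<notin> ball1 y (C - 3)" if "x \<in> set P" for x
      using arrives_cases[OF P that] da by (auto simp: ball1_def)
    then show ?thesis using sub by blast
  qed
  have QX: "set Q \<inter> ball1 origin K = {}"
  proof -
    have "x \<notin> ball1 y (C - 3)" if "x \<in> set Q" for x
      using arrives_cases[OF Q that] db by (auto simp: ball1_def)
    then show ?thesis using sub by blast
  qed
  have uX: "shift y u 1 \<in> ball1 origin K" if "u \<in> dirs" for u
    using that yL K dist1_triangle[of origin "shift y u 1" y] by (simp add: ball1_def)
  have C2: "2 \<le> C" using K m dist1_nonneg[of origin y] by linarith
  obtain p q P1 Q1 a1 b1 where 1: "p \<in> dirs" "q \<in> dirs" "p \<noteq> q"
    "1 \<le> part y a p" "1 \<le> part y b q"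
    "arrives (ball1 origin K) a1 P1" "arrives (ball1 origin K) b1 Q1" "apart P1 Q1"
    "hd P1 = hd P" "hd Q1 = hd Q"
    "set P1 \<subseteq> set P \<union> ball1 y (C - 1)" "set Q1 \<subseteq> set Q \<union> ball1 y (C - 1)"
    "a1 \<in> arm y C a p q" "b1 \<in> arm y C b q p"
    "\<And>x x'. x \<in> arm y C a p q \<Longrightarrow> x' \<in> arm y C b q p \<Longrightarrow> 2 \<le> dist1 x x'"
    by (rule transition[OF yL P Q da db C2 PQ ab nb PX QX uX]) (assumption | rule that; assumption)+
  have hP1: "hd P1 \<notin> ball1 origin K" "hd Q1 \<notin> ball1 origin K"
    using 1 hP hQ sub ball1_subset[of y y "C - 3" C] by auto
  have d1: "dist1 origin a1 = K" "dist1 origin b1 = K"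
    using arrives_dist 1(6,7) hP1 by blast+
  have axis: "\<exists>s\<ge>2. x = shift y u s" if x: "x \<in> arm y C e u v" "u \<in> dirs" "dist1 origin x = K" for x e u v
  proof -
    have "dist1 y x \<le> dist1 y origin + dist1 origin x" by (rule dist1_triangle)
    then have "dist1 y x < C - 2" using x(3) K dist1_commute[of y origin] by simp
    then obtain s where s: "x = shift y u s" "1 \<le> s" using x(1) unfolding arm_def by auto
    have "K \<le> dist1 origin y + s"
      using dist1_triangle[of origin x y] x s by simp
    then show ?thesis using s K by (intro exI[of _ s]) auto
  qed
  obtain s where s: "2 \<le> s" "a1 = shift y p s" using axis[OF 1(13) 1(1) d1(1)] by auto
  obtain t where t: "2 \<le> t" "b1 = shift y q t" using axis[OF 1(14) 1(2) d1(2)] by auto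
  have far: "4 \<le> dist1 a1 b1"
    using dist1_two[OF 1(1-3), of y a1 b1] s t 1(1-3)
      part_shift_centre[of p p s y] part_shift_centre[of p q s y]
      part_shift_centre[of q p t y] part_shift_centre[of q q t y] by simp
  then have ab1: "a1 \<noteq> b1" by auto
  have nb1: "\<not> bad_pair d origin K w a1 b1" if w: "w \<in> dirs" for w
  proof
    assume "bad_pair d origin K w a1 b1"
    then have "dist1 a1 b1 \<le> 2" using bad_pair_dist w by blast
    then show False using far by simp
  qed
  have PX1: "set P1 \<inter> ball1 origin (K - 3) = {}" and QX1: "set Q1 \<inter> ball1 origin (K - 3) = {}"
    using arrives_cases[OF 1(6)] arrives_cases[OF 1(7)] d1
    by (force simp: ball1_def)+
  have uX1: "shift origin u 1 \<in> ball1 origin (K - 3)" if "u \<in> dirs" for u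
    using that K m by (simp add: ball1_def)
  have K2: "2 \<le> K" using K m by linarith
  obtain p2 q2 P2 Q2 a2 b2 where 2: "p2 \<in> dirs" "q2 \<in> dirs" "p2 \<noteq> q2"
    "1 \<le> part origin a1 p2" "1 \<le> part origin b1 q2"
    "arrives (ball1 origin (K - 3)) a2 P2" "arrives (ball1 origin (K - 3)) b2 Q2" "apart P2 Q2"
    "hd P2 = hd P1" "hd Q2 = hd Q1"
    "set P2 \<subseteq> set P1 \<union> ball1 origin (K - 1)" "set Q2 \<subseteq> set Q1 \<union> ball1 origin (K - 1)"
    "a2 \<in> arm origin K a1 p2 q2" "b2 \<in> arm origin K b1 q2 p2"
    "\<And>x x'. x \<in> arm origin K a1 p2 q2 \<Longrightarrow> x' \<in> arm origin K b1 q2 p2 \<Longrightarrow> 2 \<le> dist1 x x'"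
    by (rule transition[OF origin_L 1(6,7) d1 K2 1(8) ab1 nb1 PX1 QX1 uX1]) (assumption | rule that; assumption)+
  have "hd P2 \<notin> ball1 origin (K - 3)" "hd Q2 \<notin> ball1 origin (K - 3)"
    using 2(9,10) hP1 ball1_subset[of origin origin "K - 3" K] by auto
  then have d2: "dist1 origin a2 = K - 3" "dist1 origin b2 = K - 3"
    using arrives_dist 2(6,7) by blast+
  have tips: "a2 = shift origin p2 (K - 3)" "b2 = shift origin q2 (K - 3)"
    using 2(1,2,13,14) d2 K m unfolding arm_def by auto
  have "finished m N (ball1 origin (K - 3)) P2 Q2"
    using finish[OF _ _ 2(1-3,8) m, of "K - 3"] 2(6,7) tips K by simp
  then show ?thesis
  proof (rule finished_mono)
    have "ball1 origin (K - 1) \<subseteq> ball1 y C" "ball1 origin (K - 3) \<subseteq> ball1 y C"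
      "ball1 y (C - 1) \<subseteq> ball1 y C"
      by (rule ball1_subset, use K dist1_commute[of origin y] in simp)+
    then show "set P2 \<subseteq> set P \<union> ball1 y C" "set Q2 \<subseteq> set Q \<union> ball1 y C"
      "ball1 origin (K - 3) \<subseteq> ball1 y C"
      using 1(11,12) 2(11,12) by blast+
  qed (use 1(9,10) 2(9,10) in auto)
qed

section \<open>Labels of balls for a pair of paths that cannot be modified\<close>

definition entry :: "point set \<Rightarrow> point list \<Rightarrow> point \<Rightarrow> bool" where
  "entry X P a \<longleftrightarrow> (\<exists>xs ys. P = xs @ a # ys \<and> a \<in> X \<and> set xs \<inter> X = {})"

lemma entry_unique:
  assumes "entry X P a" "entry X P b"
  shows "a = b"
proof -
  have "a = hd (filter (\<lambda>x. x \<in> X) P)" if e: "entry X P a" for a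
  proof -
    obtain xs ys where xs: "P = xs @ a # ys" "a \<in> X" "set xs \<inter> X = {}"
      using e unfolding entry_def by blast
    then have "filter (\<lambda>x. x \<in> X) xs = []" by (auto simp: filter_empty_conv)
    then show ?thesis using xs by simp
  qed
  then show ?thesis using assms by metis
qed

lemma entry_subset: "entry Y P a \<Longrightarrow> X \<subseteq> Y \<Longrightarrow> a \<in> X \<Longrightarrow> entry X P a"
  unfolding entry_def by blast

lemma entry_before:
  assumes "x \<in> set xs" "x \<in> X"
  shows "\<exists>a us vs. xs = us @ a # vs \<and> a \<in> X \<and> set us \<inter> X = {}"
  using split_list_first_prop[of xs "\<lambda>x. x \<in> X"] assms by blast

lemma prefix_arrives:
  assumes "walk (us @ a # vs)" "a \<in> X" "set us \<inter> X = {}"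
  shows "arrives X a (us @ [a])"
proof -
  have "walk (us @ [a])" using assms(1) by (auto simp: walk_def successively_append_iff)
  then show ?thesis using assms by (simp add: arrives_def)
qed

text \<open>
  The ball about \<open>c\<close> has its tip in direction \<open>w\<close> at distance two above \<open>z\<close>, and its other tips are
  too far away.  If an arm meets the ball in a tip, it has come down the axis \<open>w\<close> through \<open>z\<close>, and so
  the next vertex \<open>z + w\<close> belongs to it as well.
\<close>

lemma apex_arm:
  assumes "a' \<in> arm z C a p q" "1 \<le> part z a p" "dist1 z a' \<le> C" "C + 2 \<le> k"
    "z = shift c w (k - 2)" "a' = shift c v k" "v \<in> dirs" "w \<in> dirs" "p \<in> dirs" "0 \<le> C"
  shows "v = w \<and> p = w"
proof -
  have "v = w"
  proof (rule ccontr)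
    assume ne: "v \<noteq> w"
    have "\<bar>part c z w - part c a' w\<bar> + \<bar>part c z v - part c a' v\<bar> \<le> dist1 z a'"
      by (rule dist1_two) (use assms ne in auto)
    then show False
      using assms ne part_shift_centre[of w w "k - 2" c] part_shift_centre[of w v "k - 2" c]
        part_shift_centre[of v w k c] part_shift_centre[of v v k c] by simp
  qed
  then have a': "a' = shift z w 2" using assms by simp
  have "1 \<le> part z a' p"
    using assms(1)
  proof (unfold arm_def, elim UnE)
    assume "a' \<in> {shift z p s |s. 1 \<le> s}"
    then show ?thesis using part_shift_centre[of p p _ z] assms by auto
  qed (use assms(2) in auto)
  then have "p = w" using part_shift_centre[of w p 2 z] a' assms by (auto split: if_splits)
  then show ?thesis using \<open>v = w\<close> by simp
qed

end

text \<open>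
  A pair of paths that cannot be modified.  The last assumption concerns initial segments, since
  the modified paths follow the given ones up to some vertex and never use what comes later.
\<close>

locale stuck = grid +
  fixes R G :: "point list" and m N r :: int
  assumes R: "walk R" and G: "walk G" and RG: "apart R G" and disj: "set R \<inter> set G = {}"
    and hdR: "hd R \<notin> ball1 origin r" and hdG: "hd G \<notin> ball1 origin r"
    and lastR: "adjacent d (last R) origin" and lastG: "adjacent d (last G) origin"
    and m: "1 \<le> m" "m \<le> N"
    and stuck: "\<And>P Q xs ys. R = P @ xs \<Longrightarrow> G = Q @ ys \<Longrightarrow> P \<noteq> [] \<Longrightarrow> Q \<noteq> [] \<Longrightarrow>
      \<not> finished m N (ball1 origin r) P Q"
begin

definition label :: "point \<Rightarrow> int \<Rightarrow> dir \<Rightarrow> bool" where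
  "label z C w \<longleftrightarrow> w \<in> dirs \<and> z \<in> L \<and>
     (\<exists>a b. entry (ball1 z C) R a \<and> entry (ball1 z C) G b \<and> bad_pair d z C w a b)"

lemma entry_in: "entry X R a \<Longrightarrow> a \<in> X \<and> a \<in> set R" "entry X G a \<Longrightarrow> a \<in> X \<and> a \<in> set G"
  by (auto simp: entry_def)

lemma entry_neq: "entry X R a \<Longrightarrow> entry X G b \<Longrightarrow> a \<noteq> b"
  using disj entry_in by blast

lemma label_coloured: "label z C w \<Longrightarrow> shift z w C \<in> set R \<union> set G"
  unfolding label_def bad_pair_def using entry_in by blast

lemma shift_neq_dist:
  assumes "v \<in> dirs" "w \<in> dirs" "v \<noteq> w" "0 \<le> k" "0 \<le> l"
  shows "k + l \<le> dist1 (shift z v k) (shift z w l)"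
  using dist1_two[OF assms(1-3), of z "shift z v k" "shift z w l"] assms
    part_shift_centre[of v v k z] part_shift_centre[of v w k z]
    part_shift_centre[of w v l z] part_shift_centre[of w w l z] by simp

lemma bad_pair_unique:
  assumes "bad_pair d z C v a b" "bad_pair d z C w a b" "v \<in> dirs" "w \<in> dirs" "3 \<le> C" "a \<noteq> b"
  shows "v = w"
proof (rule ccontr)
  assume ne: "v \<noteq> w"
  have far: "C + (C - 1) \<le> dist1 (shift z v C) (shift z w (C - 1))"
    "C + (C - 1) \<le> dist1 (shift z w C) (shift z v (C - 1))"
    "C + C \<le> dist1 (shift z v C) (shift z w C)"
    using shift_neq_dist assms ne by (metis diff_ge_0_iff_ge dual_order.trans one_le_numeral
        order.trans zero_le_numeral add.commute)+
  then show False using assms unfolding bad_pair_def adj_iff by auto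
qed

lemma label_unique: "label z C v \<Longrightarrow> label z C w \<Longrightarrow> 3 \<le> C \<Longrightarrow> v = w"
  unfolding label_def using entry_unique bad_pair_unique entry_neq by metis

text \<open>
  Both entries of the larger ball lie in the smaller one, hence are its entries as well, and
  the tip is the same point.
\<close>

lemma label_down:
  assumes "label z C w" "4 \<le> C" "label (shift z w 1) (C - 1) v"
  shows "label (shift z w 1) (C - 1) w"
proof -
  obtain a b where w: "w \<in> dirs" and zL: "z \<in> L" and a: "entry (ball1 z C) R a"
    and b: "entry (ball1 z C) G b" and bad: "bad_pair d z C w a b"
    using assms(1) unfolding label_def by blast
  have v: "v \<in> dirs" using assms(3) unfolding label_def by blast
  let ?z = "shift z w 1"
  have aL: "a \<in> L" and bL: "b \<in> L" using entry_in a b by (auto simp: ball1_def)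
  have sub: "ball1 ?z (C - 1) \<subseteq> ball1 z C"
    by (rule ball1_subset) (use w in simp)
  have near: "x \<in> ball1 ?z (C - 1)" if "x = shift z w C \<or> adj x (shift z w (C - 1))" for x
    using that
  proof
    assume "x = shift z w C"
    then show ?thesis using w zL assms(2) by (simp add: ball1_def dist1_shift)
  next
    assume "adj x (shift z w (C - 1))"
    then show ?thesis
      using dist1_triangle[of ?z x "shift z w (C - 1)"] dist1_shift[OF w, of z 1 "C - 1"] assms(2)
      by (simp add: adj_iff ball1_def dist1_commute)
  qed
  have "a \<in> ball1 ?z (C - 1)" "b \<in> ball1 ?z (C - 1)"
    using bad near unfolding bad_pair_def by blast+
  then have ea: "entry (ball1 ?z (C - 1)) R a" and eb: "entry (ball1 ?z (C - 1)) G b"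
    using entry_subset[OF _ sub] a b by blast+
  then have badv: "bad_pair d ?z (C - 1) v a b"
    using assms(3) entry_unique unfolding label_def by metis
  have ab: "a \<noteq> b" using entry_neq a b by blast
  have "v = w"
  proof (rule ccontr)
    assume ne: "v \<noteq> w"
    have "C - 1 + (C - 1) \<le> dist1 (shift ?z v (C - 1)) (shift ?z w (C - 1))"
      "C - 1 + (C - 2) \<le> dist1 (shift ?z v (C - 1)) (shift ?z w (C - 2))"
      "C - 2 + (C - 1) \<le> dist1 (shift ?z v (C - 2)) (shift ?z w (C - 1))"
      using shift_neq_dist[OF v w ne, of "C - 1" "C - 1" ?z]
        shift_neq_dist[OF v w ne, of "C - 1" "C - 2" ?z]
        shift_neq_dist[OF v w ne, of "C - 2" "C - 1" ?z] assms(2) by (simp_all del: shift_shift)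
    then show False using bad badv ab assms(2) unfolding bad_pair_def adj_iff
      by (auto simp: dist1_commute)
  qed
  then show ?thesis using assms(3) by simp
qed

lemma hd_prefix: "xs @ a # ys = P \<Longrightarrow> hd (xs @ [a]) = hd P"
  by (cases xs) auto

lemma prefix_apart: "R = us @ a # vs \<Longrightarrow> G = us' @ b # vs' \<Longrightarrow> apart (us @ [a]) (us' @ [b])"
  using RG unfolding no_red_green_adjacent_def by auto

lemma hd_outside:
  assumes "dist1 origin z + C \<le> r"
  shows "hd R \<notin> ball1 z C" "hd G \<notin> ball1 z C"
  using ball1_subset[OF assms] hdR hdG by auto

lemma label_big:
  assumes zL: "z \<in> L" and C: "2 * dist1 origin z + N + 12 \<le> C" and r: "dist1 origin z + C \<le> r"
  shows "\<exists>w. label z C w"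
proof (rule ccontr)
  assume no: "\<not> ?thesis"
  have near: "x \<in> ball1 z C" if "adj x origin" for x
  proof -
    have "dist1 z x \<le> dist1 origin z + 1"
      using that dist1_triangle[of z x origin] dist1_commute[of origin z] dist1_commute[of origin x]
      by (simp add: adj_iff)
    also have "\<dots> \<le> C" using C m dist1_nonneg[of origin z] by linarith
    finally show ?thesis using that by (simp add: adj_iff ball1_def)
  qed
  obtain a us vs where a: "R = us @ a # vs" "a \<in> ball1 z C" "set us \<inter> ball1 z C = {}"
    using entry_before[of "last R" R "ball1 z C"] near[OF lastR] R by (auto simp: walk_def)
  obtain b us' vs' where b: "G = us' @ b # vs'" "b \<in> ball1 z C" "set us' \<inter> ball1 z C = {}"
    using entry_before[of "last G" G "ball1 z C"] near[OF lastG] G by (auto simp: walk_def)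
  have ent: "entry (ball1 z C) R a" "entry (ball1 z C) G b" using a b unfolding entry_def by blast+
  have "finished m N (ball1 z C) (us @ [a]) (us' @ [b])"
  proof (rule win_from_ball[OF zL _ _ _ _ _ _ _ m C])
    show "arrives (ball1 z C) a (us @ [a])" "arrives (ball1 z C) b (us' @ [b])"
      using prefix_arrives a b R G by metis+
    show "hd (us @ [a]) \<notin> ball1 z C" "hd (us' @ [b]) \<notin> ball1 z C"
      using hd_prefix a(1) b(1) hd_outside[OF r] by metis+
    show "apart (us @ [a]) (us' @ [b])" using prefix_apart a b by blast
    show "a \<noteq> b" using entry_neq ent by blast
    show "\<not> bad_pair d z C w a b" if "w \<in> dirs" for w
      using no ent that zL unfolding label_def by blast
  qed
  then have "finished m N (ball1 origin r) (us @ [a]) (us' @ [b])"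
    by (rule finished_mono) (use ball1_subset[OF r] in auto)
  then show False using stuck[of "us @ [a]" vs "us' @ [b]" vs'] a b by simp
qed

text \<open>
  Here \<open>y\<close> is the centre of a large ball with label \<open>w\<close>, known up to an error \<open>s\<close>.  Its tip and the
  blocking vertex lie in the small ball about \<open>z\<close>, so the small ball is entered no later than
  the large one.  Were the entries of the small ball not bad, the walks could be continued
  to the ball of radius \<open>K - s - 1\<close> about \<open>c\<close>, which lies inside the large ball and is therefore still
  untouched, and by \<open>apex_arm\<close> the entries there would not be bad either.
\<close>

lemma label_small:
  assumes cL: "c \<in> L" and yL: "y \<in> ball1 c s" and lab: "label y K w"
    and z: "z = shift c w (K - s - 3)" and s: "0 \<le> s"
    and C: "2 * s + 5 \<le> C" "C + s + 3 \<le> K"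
    and K: "2 * dist1 origin c + N + 12 \<le> K - s - 1"
    and r: "dist1 origin c + s + K \<le> r" "dist1 origin z + C \<le> r"
  shows "\<exists>v. label z C v"
proof (rule ccontr)
  assume no: "\<not> ?thesis"
  have w: "w \<in> dirs" and yl: "y \<in> L" using lab unfolding label_def by auto
  have zL: "z \<in> L" using z cL w by simp
  have dcy: "dist1 c y \<le> s" using yL by (simp add: ball1_def)
  obtain a0 b0 where e0: "entry (ball1 y K) R a0" "entry (ball1 y K) G b0"
    and bad0: "bad_pair d y K w a0 b0" using lab unfolding label_def by blast
  have zK: "dist1 z (shift y w l) \<le> s + \<bar>K - s - 3 - l\<bar>" for l
  proof -
    have "dist1 z (shift y w l) \<le> dist1 z (shift c w l) + dist1 (shift c w l) (shift y w l)"
      by (rule dist1_triangle)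
    then show ?thesis using dcy z by (simp add: dist1_shift[OF w] dist1_shift_both)
  qed
  have near: "x \<in> ball1 z C" if "x \<in> L" "x = shift y w K \<or> adj x (shift y w (K - 1))" for x
    using that(2)
  proof
    assume "x = shift y w K"
    then show ?thesis using zK[of K] C s that(1) by (simp add: ball1_def)
  next
    assume "adj x (shift y w (K - 1))"
    then show ?thesis using zK[of "K - 1"] C s that(1)
        dist1_triangle[of z x "shift y w (K - 1)"] by (simp add: ball1_def adj_iff dist1_commute)
  qed
  have "a0 \<in> L" "b0 \<in> L" using e0 entry_in by (auto simp: ball1_def)
  then have ab0: "a0 \<in> ball1 z C" "b0 \<in> ball1 z C"
    using near bad0 unfolding bad_pair_def by blast+
  have ry: "dist1 origin y + K \<le> r" using r dcy dist1_triangle[of origin y c] by simp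
  have main: "\<exists>a us vs. P = us @ a # vs \<and> a \<in> ball1 z C \<and> set us \<inter> ball1 z C = {} \<and>
      set (us @ [a]) \<inter> ball1 y (K - 1) = {}"
    if ent: "entry (ball1 y K) P x" and xC: "x \<in> ball1 z C" and wP: "walk P"
      and hP: "hd P \<notin> ball1 y K" for P x
  proof -
    obtain xs ys where P: "P = xs @ x # ys" "x \<in> ball1 y K" "set xs \<inter> ball1 y K = {}"
      using ent unfolding entry_def by blast
    have "arrives (ball1 y K) x (xs @ [x])" using prefix_arrives P wP by metis
    moreover have "hd (xs @ [x]) \<notin> ball1 y K" using hd_prefix P(1) hP by metis
    ultimately have "dist1 y x = K" by (rule arrives_dist)
    then have av: "set (xs @ [x]) \<inter> ball1 y (K - 1) = {}" using P(3) by (auto simp: ball1_def)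
    obtain a us vs where u: "xs @ [x] = us @ a # vs" "a \<in> ball1 z C" "set us \<inter> ball1 z C = {}"
      using entry_before[of x "xs @ [x]" "ball1 z C"] xC by auto
    have "P = us @ a # (vs @ ys)" using P(1) u(1) by (metis append.assoc append_Cons append_Nil)
    moreover have "set (us @ [a]) \<subseteq> set (xs @ [x])" unfolding u(1) by auto
    ultimately show ?thesis using u(2,3) av by blast
  qed
  obtain a us vs where a: "R = us @ a # vs" "a \<in> ball1 z C" "set us \<inter> ball1 z C = {}"
      "set (us @ [a]) \<inter> ball1 y (K - 1) = {}"
    using main[OF e0(1) ab0(1) R] hd_outside[OF ry] by blast
  obtain b us' vs' where b: "G = us' @ b # vs'" "b \<in> ball1 z C" "set us' \<inter> ball1 z C = {}"
      "set (us' @ [b]) \<inter> ball1 y (K - 1) = {}"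
    using main[OF e0(2) ab0(2) G] hd_outside[OF ry] by blast
  \<comment> \<open>The ball of radius k about c has its tip exactly at z + 2 w.\<close>
  define k where "k = K - s - 1"
  have sub: "ball1 c k \<subseteq> ball1 y (K - 1)"
    by (rule ball1_subset) (use dcy dist1_commute[of c y] in \<open>simp add: k_def\<close>)
  have zc: "z = shift c w (k - 2)" using z by (simp add: k_def)
  have ent: "entry (ball1 z C) R a" "entry (ball1 z C) G b" using a b unfolding entry_def by blast+
  have arr: "arrives (ball1 z C) a (us @ [a])" "arrives (ball1 z C) b (us' @ [b])"
    using prefix_arrives a b R G by metis+
  have hds: "hd (us @ [a]) = hd R" "hd (us' @ [b]) = hd G"
    using hd_prefix a(1) b(1) by metis+
  have da: "dist1 z a = C" and db: "dist1 z b = C"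
    using arrives_dist arr hds hd_outside[OF r(2)] by metis+
  have nb: "\<not> bad_pair d z C v a b" if "v \<in> dirs" for v
    using no ent that zL unfolding label_def by blast
  have "2 \<le> C" using C s by simp
  have uX: "shift z u 1 \<in> ball1 c k" if "u \<in> dirs" for u
    using dist1_triangle[of c "shift z u 1" z] that zc w zL C s
    by (simp add: ball1_def k_def)
  have fresh: "set (us @ [a]) \<inter> ball1 c k = {}" "set (us' @ [b]) \<inter> ball1 c k = {}"
    using a(4) b(4) sub by blast+
  note tr = transition[OF zL arr da db \<open>2 \<le> C\<close> prefix_apart[OF a(1) b(1)] entry_neq[OF ent] nb
      fresh uX]
  obtain p q P Q a' b' where pq: "p \<in> dirs" "q \<in> dirs" "p \<noteq> q"
    and ap: "1 \<le> part z a p" "1 \<le> part z b q"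
    and P: "arrives (ball1 c k) a' P" and Q: "arrives (ball1 c k) b' Q" and PQ: "apart P Q"
    and hPQ: "hd P = hd (us @ [a])" "hd Q = hd (us' @ [b])"
    and sPQ: "set P \<subseteq> set (us @ [a]) \<union> ball1 z (C - 1)" "set Q \<subseteq> set (us' @ [b]) \<union> ball1 z (C - 1)"
    and a': "a' \<in> arm z C a p q" and b': "b' \<in> arm z C b q p"
    and far: "\<And>x y. x \<in> arm z C a p q \<Longrightarrow> y \<in> arm z C b q p \<Longrightarrow> 2 \<le> dist1 x y"
    by (rule tr) (assumption | rule that; assumption)+
  have "a' \<in> set P" "b' \<in> set Q" "a' \<in> ball1 c k" "b' \<in> ball1 c k"
    using P Q by (auto simp: arrives_def walk_def)
  then have "a' \<in> ball1 z (C - 1)" "b' \<in> ball1 z (C - 1)"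
    using sPQ fresh by blast+
  then have da': "dist1 z a' \<le> C" "dist1 z b' \<le> C" by (auto simp: ball1_def)
  have axis1: "shift z p 1 \<in> arm z C a p q" "shift z q 1 \<in> arm z C b q p"
    unfolding arm_def by auto
  have "C + 2 \<le> k" using C(2) by (simp add: k_def)
  have nb': "\<not> bad_pair d c k v a' b'" if v: "v \<in> dirs" for v
  proof
    assume "bad_pair d c k v a' b'"
    then consider "a' = shift c v k" "adj b' (shift c v (k - 1))"
      | "b' = shift c v k" "adj a' (shift c v (k - 1))" unfolding bad_pair_def by blast
    then show False
    proof cases
      case 1
      then have "v = w \<and> p = w"
        using apex_arm[OF a' ap(1) da'(1) \<open>C + 2 \<le> k\<close> zc _ v w pq(1)] \<open>2 \<le> C\<close> by simp
      then have "shift c v (k - 1) = shift z p 1" using zc by simp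
      then have "2 \<le> dist1 (shift c v (k - 1)) b'" using far[OF axis1(1) b'] by simp
      then show False using 1(2) by (simp add: adj_iff dist1_commute)
    next
      case 2
      then have "v = w \<and> q = w"
        using apex_arm[OF b' ap(2) da'(2) \<open>C + 2 \<le> k\<close> zc _ v w pq(2)] \<open>2 \<le> C\<close> by simp
      then have "shift c v (k - 1) = shift z q 1" using zc by simp
      then have "2 \<le> dist1 a' (shift c v (k - 1))" using far[OF a' axis1(2)] by simp
      then show False using 2(2) by (simp add: adj_iff)
    qed
  qed
  have "a' \<noteq> b'" using far[OF a' b'] by auto
  have rc: "dist1 origin c + k \<le> r" using r s by (simp add: k_def)
  have "finished m N (ball1 c k) P Q"
    by (rule win_from_ball[OF cL P Q _ _ PQ \<open>a' \<noteq> b'\<close> nb' m])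
      (use hPQ hds hd_outside[OF rc] K in \<open>auto simp: k_def\<close>)
  then have "finished m N (ball1 origin r) (us @ [a]) (us' @ [b])"
  proof (rule finished_mono)
    have "ball1 z (C - 1) \<subseteq> ball1 origin r" "ball1 c k \<subseteq> ball1 origin r"
      by (rule ball1_subset, use r rc in simp)+
    then show "set P \<subseteq> set (us @ [a]) \<union> ball1 origin r" "set Q \<subseteq> set (us' @ [b]) \<union> ball1 origin r"
      "ball1 c k \<subseteq> ball1 origin r" using sPQ by blast+
  qed (use hPQ in auto)
  then show False using stuck[of "us @ [a]" vs "us' @ [b]" vs'] a b by simp
qed

end

section \<open>Labellings that shift along their directions\<close>

context grid begin

text \<open>
  If a colour is missing from some ball at the next smaller scale, restrict to that ball and
  forget the colour; this can happen only as often as there are colours.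
\<close>

lemma relatively_dense:
  fixes N :: "nat \<Rightarrow> int"
  assumes "finite W" "card W \<le> j" "x \<in> L" "\<And>z. z \<in> ball1 x (N j) \<Longrightarrow> f z \<in> W"
    "\<And>i. 0 \<le> N i"
  shows "\<exists>i<j. \<exists>x'\<in>L. \<exists>w\<in>W. ball1 x' (N (Suc i)) \<subseteq> ball1 x (N j) \<and>
     (\<forall>c\<in>L. ball1 c (N i) \<subseteq> ball1 x' (N (Suc i)) \<longrightarrow> (\<exists>y\<in>ball1 c (N i). f y = w))"
  using assms(1-4)
proof (induction j arbitrary: W x)
  case 0
  have "x \<in> ball1 x (N 0)" using 0 assms(5) by (simp add: ball1_def)
  then have "f x \<in> W" by (rule 0(4))
  then show ?case using 0(1,2) by auto
next
  case (Suc j)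
  have "x \<in> ball1 x (N (Suc j))" using Suc assms(5) by (simp add: ball1_def)
  then have w: "f x \<in> W" using Suc by blast
  show ?case
  proof (cases "\<forall>c\<in>L. ball1 c (N j) \<subseteq> ball1 x (N (Suc j)) \<longrightarrow> (\<exists>y\<in>ball1 c (N j). f y = f x)")
    case True
    then show ?thesis using w Suc(4) by (intro exI[of _ j] conjI bexI[of _ x] bexI[of _ "f x"]) auto
  next
    case False
    then obtain c where c: "c \<in> L" "ball1 c (N j) \<subseteq> ball1 x (N (Suc j))"
      "\<forall>y\<in>ball1 c (N j). f y \<noteq> f x" by blast
    have card: "card (W - {f x}) \<le> j" using Suc(2,3) w by simp
    have "f z \<in> W - {f x}" if "z \<in> ball1 c (N j)" for z
      using that c(2,3) Suc(5) by blast
    from Suc(1)[OF _ card c(1) this] Suc(2)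
    obtain i x' w' where "i < j" "x' \<in> L" "w' \<in> W" "ball1 x' (N (Suc i)) \<subseteq> ball1 c (N j)"
     "\<forall>c\<in>L. ball1 c (N i) \<subseteq> ball1 x' (N (Suc i)) \<longrightarrow> (\<exists>y\<in>ball1 c (N i). f y = w')"
      by auto
    then show ?thesis using c(2) by (intro exI[of _ i] conjI bexI[of _ x'] bexI[of _ w']) auto
  qed
qed

definition box :: "point \<Rightarrow> nat \<Rightarrow> point set" where
  "box c n = {x \<in> L. \<forall>i<d. c i \<le> x i \<and> x i < c i + int n}"

lemma box_image:
  "box c n = (\<lambda>g i. if i < d then c i + int (g i) else 0) ` ({..<d} \<rightarrow>\<^sub>E {..<n})"
proof
  show "box c n \<subseteq> (\<lambda>g i. if i < d then c i + int (g i) else 0) ` ({..<d} \<rightarrow>\<^sub>E {..<n})"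
  proof
    fix x assume x: "x \<in> box c n"
    let ?g = "\<lambda>i\<in>{..<d}. nat (x i - c i)"
    have "?g \<in> {..<d} \<rightarrow>\<^sub>E {..<n}" using x by (auto simp: box_def)
    moreover have "x = (\<lambda>i. if i < d then c i + int (?g i) else 0)"
      using x by (auto simp: box_def lattice_def)
    ultimately show "x \<in> (\<lambda>g i. if i < d then c i + int (g i) else 0) ` ({..<d} \<rightarrow>\<^sub>E {..<n})"
      by blast
  qed
  show "(\<lambda>g i. if i < d then c i + int (g i) else 0) ` ({..<d} \<rightarrow>\<^sub>E {..<n}) \<subseteq> box c n"
    by (auto simp: box_def lattice_def PiE_def Pi_def)
qed

lemma finite_box [simp]: "finite (box c n)"
  unfolding box_image by (intro finite_imageI finite_PiE) auto

lemma card_box: "card (box c n) = n ^ d"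
proof -
  have "inj_on (\<lambda>g i. if i < d then c i + int (g i) else 0) ({..<d} \<rightarrow>\<^sub>E {..<n})"
  proof (rule inj_onI)
    fix g h :: "nat \<Rightarrow> nat"
    assume g: "g \<in> {..<d} \<rightarrow>\<^sub>E {..<n}" and h: "h \<in> {..<d} \<rightarrow>\<^sub>E {..<n}"
      and eq: "(\<lambda>i. if i < d then c i + int (g i) else 0) = (\<lambda>i. if i < d then c i + int (h i) else 0)"
    show "g = h"
    proof (rule PiE_ext[OF g h])
      fix i assume "i \<in> {..<d}"
      then show "g i = h i" using fun_cong[OF eq, of i] by simp
    qed
  qed
  then have "card (box c n) = card ({..<d} \<rightarrow>\<^sub>E {..<n})"
    unfolding box_image by (rule card_image)
  also have "\<dots> = n ^ d" by (simp add: card_PiE)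
  finally show ?thesis .
qed

lemma power_gap: "(a + 2) ^ k \<le> a ^ k + 2 * k * (a + 2) ^ (k - 1)" for a k :: nat
proof (induction k)
  case (Suc k)
  have "(a + 2) ^ Suc k = a * (a + 2) ^ k + 2 * (a + 2) ^ k" by simp
  also have "\<dots> \<le> a * (a ^ k + 2 * k * (a + 2) ^ (k - 1)) + 2 * (a + 2) ^ k"
    using Suc by simp
  also have "a * (2 * k * (a + 2) ^ (k - 1)) \<le> 2 * k * (a + 2) ^ k"
    by (cases k) (auto simp: algebra_simps)
  then have "a * (a ^ k + 2 * k * (a + 2) ^ (k - 1)) + 2 * (a + 2) ^ k
      \<le> a ^ Suc k + 2 * Suc k * (a + 2) ^ (Suc k - 1)" by (simp add: algebra_simps)
  finally show ?case .
qed simp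

lemma many_boxes:
  fixes n M :: nat
  shows "\<exists>K. M * ((K * n + 2) ^ d - (K * n) ^ d) < K ^ d"
proof -
  define e where "e = d - 1"
  have d: "d = Suc e" using two_le_d by (simp add: e_def)
  define K where "K = 2 * d * M * (n + 2) ^ e + 1"
  have "(K * n + 2) ^ d - (K * n) ^ d \<le> 2 * d * (K * n + 2) ^ e"
    using power_gap[of "K * n" d] by (simp add: e_def)
  also have "(K * n + 2) ^ e \<le> (K * (n + 2)) ^ e"
    by (rule power_mono) (auto simp: K_def algebra_simps)
  finally have "M * ((K * n + 2) ^ d - (K * n) ^ d) \<le> M * (2 * d * (K * (n + 2)) ^ e)"
    by simp
  also have "\<dots> = (2 * d * M * (n + 2) ^ e) * K ^ e" by (simp only: power_mult_distrib ac_simps)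
  also have "\<dots> < K * K ^ e"
    by (rule mult_strict_right_mono) (auto simp: K_def)
  finally show ?thesis using d by auto
qed

lemma shift_box: "z \<in> box c n \<Longrightarrow> u \<in> dirs \<Longrightarrow> shift z u 1 \<in> box (\<lambda>i. c i - 1) (n + 2)"
  using dirsD[of u] by (fastforce simp: box_def shift_def lattice_def)

text \<open>
  Moving centres along their labels is injective and has displacement one, so per radius it misses
  at most the \<open>(K n + 2)^d - (K n)^d\<close> points gained by enlarging the box.  These are fewer
  than the \<open>K^d\<close> disjoint boxes of side \<open>n\<close>, one of which is thus hit completely.
\<close>

lemma exact_box:
  fixes lab :: "point \<Rightarrow> int \<Rightarrow> dir \<Rightarrow> bool" and C0 :: int and M K n :: nat
  assumes K: "M * ((K * n + 2) ^ d - (K * n) ^ d) < K ^ d"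
    and dirs: "\<And>z C w. lab z C w \<Longrightarrow> w \<in> dirs"
    and uniq: "\<And>z C. z \<in> box (\<lambda>i. c0 i - 1) (K * n + 2) \<Longrightarrow> C0 \<le> C \<Longrightarrow> C \<le> C0 + int M \<Longrightarrow>
       \<exists>!w. lab z C w"
    and down: "\<And>z C w. z \<in> box c0 (K * n) \<Longrightarrow> C0 < C \<Longrightarrow> C \<le> C0 + int M \<Longrightarrow> lab z C w \<Longrightarrow>
       lab (shift z w 1) (C - 1) w"
    and c0: "c0 \<in> L"
  shows "\<exists>c\<in>L. box c n \<subseteq> box c0 (K * n) \<and>
    (\<forall>y\<in>box c n. \<forall>C w. C0 < C \<and> C \<le> C0 + int M \<and> lab y (C - 1) w \<longrightarrow> lab (shift y w (-1)) C w)"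
proof (rule ccontr)
  assume no: "\<not> ?thesis"
  let ?B = "box c0 (K * n)" and ?B' = "box (\<lambda>i. c0 i - 1) (K * n + 2)"
  have BB: "?B \<subseteq> ?B'" by (fastforce simp: box_def)
  define miss where "miss C = {y \<in> ?B. \<exists>w. lab y (C - 1) w \<and> \<not> lab (shift y w (-1)) C w}" for C
  have card_miss: "card (miss C) \<le> (K * n + 2) ^ d - (K * n) ^ d"
    if C: "C0 < C" "C \<le> C0 + int M" for C
  proof -
    define f where "f z = (THE w. lab z C w)" for z
    have f: "lab z C (f z)" if "z \<in> ?B" for z
      unfolding f_def by (rule theI') (use uniq[of z C] that BB C in auto)
    define \<phi> where "\<phi> z = shift z (f z) 1" for z
    have \<phi>lab: "lab (\<phi> z) (C - 1) (f z)" if "z \<in> ?B" for z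
      using down[OF that C f[OF that]] by (simp add: \<phi>_def)
    have \<phi>B: "\<phi> z \<in> ?B'" if "z \<in> ?B" for z
      unfolding \<phi>_def using shift_box[OF that dirs[OF f[OF that]]] .
    have u: "v = w" if "y \<in> ?B'" "lab y (C - 1) v" "lab y (C - 1) w" for y v w
      using uniq[of y "C - 1"] that C by auto
    have undo: "shift (\<phi> z) (f z) (-1) = z" for z by (simp add: \<phi>_def)
    have inj: "inj_on \<phi> ?B"
      by (rule inj_onI) (metis undo u \<phi>lab \<phi>B)
    have "miss C \<subseteq> ?B' - \<phi> ` ?B"
    proof
      fix y assume y: "y \<in> miss C"
      then obtain w where w: "lab y (C - 1) w" "\<not> lab (shift y w (-1)) C w" "y \<in> ?B"
        by (auto simp: miss_def)
      have "y \<noteq> \<phi> z" if "z \<in> ?B" for z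
        using w u[OF \<phi>B[OF that] _ \<phi>lab[OF that]] undo[of z] f[OF that] by metis
      then show "y \<in> ?B' - \<phi> ` ?B" using w(3) BB by blast
    qed
    then have "card (miss C) \<le> card (?B' - \<phi> ` ?B)" by (intro card_mono) auto
    also have "\<dots> = card ?B' - card ?B"
      using \<phi>B inj by (subst card_Diff_subset) (auto simp: card_image)
    finally show ?thesis by (simp add: card_box)
  qed
  \<comment> \<open>The corners of the disjoint boxes of side n.\<close>
  define corner where "corner g = (\<lambda>i. if i < d then c0 i + int (n * g i) else 0)" for g :: "nat \<Rightarrow> nat"
  let ?I = "{..<d} \<rightarrow>\<^sub>E {..<K}"
  have cornerL: "corner g \<in> L" for g by (auto simp: corner_def lattice_def)
  have cornerB: "box (corner g) n \<subseteq> ?B" if g: "g \<in> ?I" for g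
  proof
    fix x assume x: "x \<in> box (corner g) n"
    have "c0 i \<le> x i \<and> x i < c0 i + int (K * n)" if i: "i < d" for i
    proof -
      have gi: "Suc (g i) \<le> K" using g i by (auto simp: PiE_def Pi_def Suc_le_eq)
      have "c0 i + int (n * g i) \<le> x i" "x i < c0 i + int (n * g i) + int n"
        using x i by (auto simp: box_def corner_def)
      moreover have "n * g i + n \<le> K * n" using mult_le_mono1[OF gi, of n] by (simp add: algebra_simps)
      then have "int (n * g i) + int n \<le> int (K * n)" by (metis of_nat_add of_nat_le_iff)
      ultimately show ?thesis by linarith
    qed
    then show "x \<in> ?B" using x by (auto simp: box_def)
  qed
  have "\<exists>C y. C0 < C \<and> C \<le> C0 + int M \<and> y \<in> box (corner g) n \<and> y \<in> miss C" if "g \<in> ?I" for g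
    using no cornerL[of g] cornerB[OF that] unfolding miss_def by blast
  then obtain Cf yf where cy: "\<And>g. g \<in> ?I \<Longrightarrow> C0 < Cf g \<and> Cf g \<le> C0 + int M \<and>
      yf g \<in> box (corner g) n \<and> yf g \<in> miss (Cf g)" by metis
  have inj: "inj_on (\<lambda>g. (Cf g, yf g)) ?I"
  proof (rule inj_onI)
    fix g h assume g: "g \<in> ?I" and h: "h \<in> ?I" and "(Cf g, yf g) = (Cf h, yf h)"
    then have y: "yf g \<in> box (corner g) n" "yf g \<in> box (corner h) n"
      using cy[OF g] cy[OF h] by simp_all
    show "g = h"
    proof (rule PiE_ext[OF g h])
      fix i assume i: "i \<in> {..<d}"
      have *: "int (n * k) \<le> t \<Longrightarrow> t < int (n * k) + int n \<Longrightarrow> k = nat (t div int n)" for k t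
      proof -
        assume a: "int (n * k) \<le> t" "t < int (n * k) + int n"
        have "t div int n = int k"
          by (rule int_div_pos_eq[of _ _ _ "t - int n * int k"]) (use a in auto)
        then show "k = nat (t div int n)" by simp
      qed
      have "int (n * g i) \<le> yf g i - c0 i" "yf g i - c0 i < int (n * g i) + int n"
        "int (n * h i) \<le> yf g i - c0 i" "yf g i - c0 i < int (n * h i) + int n"
        using y i by (auto simp: box_def corner_def)
      then show "g i = h i" using * by metis
    qed
  qed
  have "K ^ d = card ?I" by (simp add: card_PiE)
  also have "\<dots> = card ((\<lambda>g. (Cf g, yf g)) ` ?I)" using inj by (simp add: card_image)
  also have "\<dots> \<le> card (SIGMA C:{C0<..C0 + int M}. miss C)"
    by (rule card_mono) (use cy in \<open>auto simp: miss_def\<close>)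
  also have "\<dots> = (\<Sum>C\<in>{C0<..C0 + int M}. card (miss C))"
    by (rule card_SigmaI) (auto simp: miss_def)
  also have "\<dots> \<le> (\<Sum>C\<in>{C0<..C0 + int M}. (K * n + 2) ^ d - (K * n) ^ d)"
    by (rule sum_mono) (use card_miss in auto)
  also have "\<dots> = M * ((K * n + 2) ^ d - (K * n) ^ d)" by simp
  finally show False using K by simp
qed

definition minus_units :: "point \<Rightarrow> dir set \<Rightarrow> point" where
  "minus_units x I = (\<lambda>i. x i - (\<Sum>u\<in>I. if fst u = i then snd u else 0))"

lemma minus_units_L: "x \<in> L \<Longrightarrow> I \<subseteq> dirs \<Longrightarrow> minus_units x I \<in> L"
  unfolding minus_units_def lattice_def by (auto intro!: sum.neutral dest!: subsetD dirsD)

lemma minus_units_empty [simp]: "minus_units x {} = x"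
  by (simp add: minus_units_def)

lemma minus_units_dist:
  assumes "I \<subseteq> dirs" shows "dist1 x (minus_units x I) \<le> int (card I)"
proof -
  have "dist1 x (minus_units x I) = (\<Sum>i<d. \<bar>\<Sum>u\<in>I. if fst u = i then snd u else 0\<bar>)"
    unfolding l1_dist_def minus_units_def by simp
  also have "\<dots> \<le> (\<Sum>i<d. \<Sum>u\<in>I. \<bar>if fst u = i then snd u else 0\<bar>)"
    by (intro sum_mono sum_abs)
  also have "\<dots> = (\<Sum>u\<in>I. \<Sum>i<d. \<bar>if fst u = i then snd u else 0\<bar>)" by (rule sum.swap)
  also have "\<dots> = (\<Sum>u\<in>I. 1)"
  proof (rule sum.cong)
    fix u assume "u \<in> I"
    then have u: "fst u < d" "\<bar>snd u\<bar> = 1" using assms dirsD by fastforce+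
    have "(\<Sum>i<d. \<bar>if fst u = i then snd u else 0\<bar>) = (\<Sum>i<d. if fst u = i then \<bar>snd u\<bar> else 0)"
      by (rule sum.cong) auto
    then show "(\<Sum>i<d. \<bar>if fst u = i then snd u else 0\<bar>) = 1" using u by simp
  qed simp
  finally show ?thesis by simp
qed

lemma shift_minus_units_insert:
  assumes "finite I" "w \<notin> I"
  shows "shift (minus_units x (insert w I)) w (k + 1) = shift (minus_units x I) w k"
  using assms by (auto simp: shift_def minus_units_def algebra_simps)

text \<open>
  Adding \<open>w\<close> to \<open>I\<close> moves \<open>x\<close> one step back and lets \<open>k + card I\<close> grow by one, so the argument of \<open>h\<close> does
  not change, whereas the sign does.  In terms of translations this is the product
  \<open>\<Prod>u. 1 - T w / T u\<close>, which contains a vanishing factor.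
\<close>

lemma alternating:
  fixes h :: "point \<Rightarrow> int"
  assumes w: "w \<in> dirs"
  shows "(\<Sum>I\<in>Pow dirs. (-1) ^ card I * h (shift (minus_units x I) w (k + int (card I)))) = 0"
proof -
  let ?D = "dirs - {w}"
  let ?F = "\<lambda>I. (-1) ^ card I * h (shift (minus_units x I) w (k + int (card I)))"
  have P: "Pow dirs = Pow ?D \<union> insert w ` Pow ?D"
    using Pow_insert[of w ?D] w by (simp add: insert_absorb)
  have inj: "inj_on (insert w) (Pow ?D)" by (rule inj_onI) blast
  have "sum ?F (Pow dirs) = sum ?F (Pow ?D) + sum ?F (insert w ` Pow ?D)"
    unfolding P by (rule sum.union_disjoint) auto
  also have "sum ?F (insert w ` Pow ?D) = (\<Sum>I\<in>Pow ?D. ?F (insert w I))"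
    using sum.reindex[OF inj, of ?F] by simp
  also have "\<dots> = (\<Sum>I\<in>Pow ?D. - ?F I)"
  proof (rule sum.cong)
    fix I assume I: "I \<in> Pow ?D"
    then have fin: "finite I" "w \<notin> I" using finite_subset[of I dirs] by auto
    have "shift (minus_units x (insert w I)) w (k + int (card (insert w I))) = shift (minus_units x I) w (k + int (card I))"
      using shift_minus_units_insert[OF fin, of x "k + int (card I)"] fin by (simp add: algebra_simps)
    then show "?F (insert w I) = - ?F I" using fin by simp
  qed simp
  finally show ?thesis by (simp add: sum_negf)
qed

text \<open>
  Summing \<open>alternating\<close> over all \<open>w\<close> expresses \<open>b k x\<close> by values of \<open>b\<close> at \<open>k + 1, ..., k + 2 d\<close>, and the
  constant one is a solution.
\<close>

lemma descent:
  fixes h :: "dir \<Rightarrow> point \<Rightarrow> int" and \<rho> :: int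
  defines "b \<equiv> \<lambda>k x. \<Sum>w\<in>dirs. h w (shift x w k)"
  assumes base: "\<And>k x. 0 \<le> k \<Longrightarrow> k < 2 * int d \<Longrightarrow> x \<in> ball1 x0 \<rho> \<Longrightarrow> b k x = 1"
  shows "- int j \<le> k \<Longrightarrow> k < 2 * int d \<Longrightarrow> x \<in> ball1 x0 (\<rho> - 2 * int d * int j) \<Longrightarrow> b k x = 1"
proof (induction j arbitrary: k x)
  case 0
  then show ?case using base by simp
next
  case (Suc j)
  have xs: "x \<in> L" "dist1 x0 x \<le> \<rho> - 2 * int d * (int j + 1)"
    using Suc(4) by (auto simp: ball1_def algebra_simps)
  show ?case
  proof (cases "- int j \<le> k")
    case True
    have "x \<in> ball1 x0 (\<rho> - 2 * int d * int j)" using xs by (simp add: ball1_def algebra_simps)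
    then show ?thesis using Suc True by blast
  next
    case False
    then have k: "k = - int j - 1" using Suc(2) by simp
    have sub1: "b (k + int (card I)) (minus_units x I) = 1" if I: "I \<in> Pow dirs - {{}}" for I
    proof (rule Suc(1))
      have fin: "finite I" using I finite_subset[of I dirs] by auto
      have c: "0 < card I" "card I \<le> 2 * d"
        using I fin card_mono[of dirs I] card_dirs by (auto simp: card_gt_0_iff)
      show "- int j \<le> k + int (card I)" "k + int (card I) < 2 * int d" using k c by auto
      have "dist1 x0 (minus_units x I) \<le> dist1 x0 x + dist1 x (minus_units x I)" by (rule dist1_triangle)
      also have "\<dots> \<le> \<rho> - 2 * int d * (int j + 1) + 2 * int d"
        using xs minus_units_dist[of I x] I c by auto
      finally show "minus_units x I \<in> ball1 x0 (\<rho> - 2 * int d * int j)"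
        using minus_units_L[of x I] xs I by (simp add: ball1_def algebra_simps)
    qed
    have "(\<Sum>I\<in>Pow dirs. (-1) ^ card I * b (k + int (card I)) (minus_units x I))
        = (\<Sum>w\<in>dirs. \<Sum>I\<in>Pow dirs. (-1) ^ card I * h w (shift (minus_units x I) w (k + int (card I))))"
      unfolding b_def sum_distrib_left by (rule sum.swap)
    also have "\<dots> = 0" by (simp add: alternating)
    finally have 1: "(\<Sum>I\<in>Pow dirs. (-1) ^ card I * b (k + int (card I)) (minus_units x I)) = 0" .
    have "\<exists>w. w \<in> dirs" using two_le_d by (intro exI[of _ "(0, 1)"]) (auto simp: dirs_def)
    then obtain w where "w \<in> dirs" by blast
    from alternating[OF this, of "\<lambda>_. 1"]
    have 2: "(\<Sum>I\<in>Pow dirs. (-1) ^ card I) = (0::int)" by simp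
    have s: "(\<Sum>I\<in>Pow dirs. F I) = F {} + (\<Sum>I\<in>Pow dirs - {{}}. F I)" for F :: "dir set \<Rightarrow> int"
      by (rule sum.remove) auto
    have "(\<Sum>I\<in>Pow dirs - {{}}. (-1) ^ card I * b (k + int (card I)) (minus_units x I))
        = (\<Sum>I\<in>Pow dirs - {{}}. (-1) ^ card I)"
      by (rule sum.cong) (use sub1 in auto)
    then show ?thesis using 1 2 s[of "\<lambda>I. (-1) ^ card I * b (k + int (card I)) (minus_units x I)"]
        s[of "\<lambda>I. (-1) ^ card I"] by simp
  qed
qed

lemma box_dist: "x \<in> box c n \<Longrightarrow> y \<in> box c n \<Longrightarrow> dist1 x y \<le> int (d * n)"
proof -
  assume "x \<in> box c n" "y \<in> box c n"
  then have "dist1 x y \<le> (\<Sum>i<d. int n)"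
    unfolding l1_dist_def by (intro sum_mono) (force simp: box_def)
  then show ?thesis by simp
qed

lemma coordinate_le: "i < d \<Longrightarrow> \<bar>x i - y i\<bar> \<le> dist1 x y"
  unfolding l1_dist_def by (rule member_le_sum) auto

text \<open>
  Purely combinatorial: \<open>lab z C w\<close> may be any labelling that is unique and passes from \<open>(z, C)\<close> to
  \<open>(z + w, C - 1)\<close>.
\<close>

lemma tips_everywhere:
  fixes C0 :: nat
  shows "\<exists>N\<ge>0. \<forall>lab x0. x0 \<in> L \<longrightarrow> (\<forall>z C w. lab z C w \<longrightarrow> w \<in> dirs) \<longrightarrow>
    (\<forall>z\<in>ball1 x0 N. \<forall>C. int C0 \<le> C \<and> C \<le> int C0 + 2 * int d \<longrightarrow> (\<exists>!w. lab z C w)) \<longrightarrow>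
    (\<forall>z C w. z \<in> ball1 x0 N \<and> shift z w 1 \<in> ball1 x0 N \<and> int C0 < C \<and> C \<le> int C0 + 2 * int d \<and>
        lab z C w \<longrightarrow> lab (shift z w 1) (C - 1) w) \<longrightarrow>
    (\<exists>x\<in>L. \<forall>y\<in>ball1 x 1. \<exists>w\<in>dirs. lab (shift y w (- int C0)) (int C0) w)"
proof -
  define \<rho> where "\<rho> = 2 * d * C0 + 1"
  define n where "n = 2 * (\<rho> + 2 * d) + 1"
  obtain K where K: "2 * d * ((K * n + 2) ^ d - (K * n) ^ d) < K ^ d" using many_boxes by blast
  define N where "N = int (d * (K * n + 2))"
  show ?thesis
  proof (intro exI[of _ N] conjI allI impI)
    fix lab :: "point \<Rightarrow> int \<Rightarrow> dir \<Rightarrow> bool" and x0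
    assume x0: "x0 \<in> L" and dirs: "\<forall>z C w. lab z C w \<longrightarrow> w \<in> dirs"
      and uniq: "\<forall>z\<in>ball1 x0 N. \<forall>C. int C0 \<le> C \<and> C \<le> int C0 + 2 * int d \<longrightarrow> (\<exists>!w. lab z C w)"
      and down: "\<forall>z C w. z \<in> ball1 x0 N \<and> shift z w 1 \<in> ball1 x0 N \<and> int C0 < C \<and>
        C \<le> int C0 + 2 * int d \<and> lab z C w \<longrightarrow> lab (shift z w 1) (C - 1) w"
    have x0b: "x0 \<in> box (\<lambda>i. x0 i - 1) (K * n + 2)"
      using x0 by (auto simp: box_def intro: add_pos_nonneg)
    have B': "box (\<lambda>i. x0 i - 1) (K * n + 2) \<subseteq> ball1 x0 N"
      using box_dist[OF x0b] by (auto simp: ball1_def N_def box_def)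
    have B: "box x0 (K * n) \<subseteq> ball1 x0 N" using B' by (fastforce simp: box_def)
    have down': "lab (shift z w 1) (C - 1) w"
      if "z \<in> box x0 (K * n)" "int C0 < C" "C \<le> int C0 + 2 * int d" "lab z C w" for z C w
      using down that B B' shift_box[OF that(1), of w] dirs by blast
    have "\<exists>c\<in>L. box c n \<subseteq> box x0 (K * n) \<and>
      (\<forall>y\<in>box c n. \<forall>C w. int C0 < C \<and> C \<le> int C0 + int (2 * d) \<and> lab y (C - 1) w \<longrightarrow>
         lab (shift y w (-1)) C w)"
    proof (rule exact_box[OF K])
      fix z C assume "z \<in> box (\<lambda>i. x0 i - 1) (K * n + 2)" "int C0 \<le> C" "C \<le> int C0 + int (2 * d)"
      then show "\<exists>!w. lab z C w" using uniq B' by (metis of_nat_mult of_nat_numeral subsetD)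
    next
      fix z C w assume "z \<in> box x0 (K * n)" "int C0 < C" "C \<le> int C0 + int (2 * d)" "lab z C w"
      then show "lab (shift z w 1) (C - 1) w" using down' by simp
    qed (use dirs x0 in blast)+
    then obtain c where c: "c \<in> L" "box c n \<subseteq> box x0 (K * n)"
      and up: "\<And>y C w. y \<in> box c n \<Longrightarrow> int C0 < C \<Longrightarrow> C \<le> int C0 + 2 * int d \<Longrightarrow>
        lab y (C - 1) w \<Longrightarrow> lab (shift y w (-1)) C w" by auto
    define x where "x = (\<lambda>i. if i < d then c i + int (\<rho> + 2 * d) else 0)"
    have xL: "x \<in> L" by (auto simp: x_def lattice_def)
    have near: "y \<in> box c n" if y: "y \<in> ball1 x (int (\<rho> + 2 * d))" for y
    proof -
      have "c i \<le> y i \<and> y i < c i + int n" if i: "i < d" for i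
      proof -
        define A where "A = int (\<rho> + 2 * d)"
        have "\<bar>x i - y i\<bar> \<le> A"
          using coordinate_le[OF i, of x y] y by (simp add: ball1_def A_def)
        moreover have "x i = c i + A" "int n = 2 * A + 1"
          using i by (simp_all add: x_def n_def A_def)
        ultimately show ?thesis by (simp add: abs_le_iff)
      qed
      then show ?thesis using y by (simp add: box_def ball1_def)
    qed
    have step: "shift y w l \<in> box c n" if "y \<in> ball1 x (int \<rho>)" "w \<in> dirs" "0 \<le> l" "l \<le> 2 * int d" for y w l
    proof (rule near)
      have "dist1 x (shift y w l) \<le> dist1 x y + dist1 y (shift y w l)" by (rule dist1_triangle)
      then show "shift y w l \<in> ball1 x (int (\<rho> + 2 * d))" using that by (simp add: ball1_def)
    qed
    define h where "h w y = (if lab y (int C0) w then 1 else (0::int))" for w y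
    have iff: "lab (shift y w (int k)) (int C0) w \<longleftrightarrow> lab y (int C0 + int k) w"
      if y: "y \<in> ball1 x (int \<rho>)" and w: "w \<in> dirs" and k: "k < 2 * d" for y w k
    proof -
      have "lab (shift y w (int k)) (int C0) w \<longleftrightarrow> lab (shift y w (int (k - l))) (int C0 + int l) w"
        if "l \<le> k" for l
        using that
      proof (induction l)
        case (Suc l)
        let ?y = "shift y w (int (k - Suc l))" and ?C = "int C0 + int (Suc l)"
        have e: "shift y w (int (k - l)) = shift ?y w 1"
          using Suc(2) by (simp add: of_nat_diff algebra_simps)
        have b1: "shift ?y w 1 \<in> box c n"
          using step[OF y w, of "int (k - l)"] k e by simp
        have b2: "?y \<in> box x0 (K * n)"
          using step[OF y w, of "int (k - Suc l)"] k c(2) by auto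
        have C: "int C0 < ?C" "?C \<le> int C0 + 2 * int d" using k Suc(2) by auto
        have "shift (shift ?y w 1) w (-1) = ?y" by simp
        then have "lab (shift ?y w 1) (?C - 1) w \<longleftrightarrow> lab ?y ?C w"
          using up[OF b1 C, of w] down'[OF b2 C, of w] by metis
        moreover have "?C - 1 = int C0 + int l" by simp
        moreover have "shift ?y w 1 = shift y w (int (k - l))" by (rule e[symmetric])
        ultimately have "lab (shift y w (int (k - l))) (int C0 + int l) w \<longleftrightarrow> lab ?y ?C w" by metis
        then show ?case using Suc by simp
      qed simp
      from this[of k] show ?thesis by simp
    qed
    have base: "(\<Sum>w\<in>dirs. h w (shift y w k)) = 1"
      if k: "0 \<le> k" "k < 2 * int d" and y: "y \<in> ball1 x (int \<rho>)" for k y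
    proof -
      obtain k' where k': "k = int k'" using k(1) nonneg_int_cases by blast
      have "(0, 1) \<in> dirs" using two_le_d by (simp add: dirs_def)
      then have "y \<in> box c n" using step[OF y, of "(0, 1)" 0] by simp
      then have "y \<in> ball1 x0 N" using c(2) B by blast
      then have "\<exists>!w. lab y (int C0 + k) w" using uniq k by simp
      then obtain w0 where w0: "\<And>w. lab y (int C0 + k) w \<longleftrightarrow> w = w0" by metis
      have "(\<Sum>w\<in>dirs. h w (shift y w k)) = (\<Sum>w\<in>dirs. if w = w0 then 1 else 0)"
      proof (rule sum.cong)
        fix w assume "w \<in> dirs"
        then have "lab (shift y w k) (int C0) w \<longleftrightarrow> w = w0"
          using iff[OF y, of w k'] k k' w0 by simp
        then show "h w (shift y w k) = (if w = w0 then 1 else 0)" by (simp add: h_def)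
      qed simp
      moreover have "w0 \<in> dirs" using w0 dirs by blast
      ultimately show ?thesis by simp
    qed
    have "\<exists>w\<in>dirs. lab (shift y w (- int C0)) (int C0) w" if y: "y \<in> ball1 x 1" for y
    proof -
      have "(\<Sum>w\<in>dirs. h w (shift y w (- int C0))) = 1"
        by (rule descent[where ?\<rho> = "int \<rho>" and ?x0.0 = x and j = C0])
          (use base y two_le_d in \<open>auto simp: \<rho>_def\<close>)
      then have "\<exists>w\<in>dirs. h w (shift y w (- int C0)) \<noteq> 0"
        by (metis (mono_tags, lifting) sum.neutral zero_neq_one)
      then show ?thesis by (auto simp: h_def split: if_splits)
    qed
    then show "\<exists>x\<in>L. \<forall>y\<in>ball1 x 1. \<exists>w\<in>dirs. lab (shift y w (- int C0)) (int C0) w"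
      using xL by blast
  qed (simp add: N_def)
qed

end

section \<open>Choice of the scales and conclusion\<close>

context grid begin

text \<open>
  The conclusion of \<open>tips_everywhere\<close> as a relation, so that a suitable \<open>T\<close> can be chosen for every
  error \<open>s\<close>.  The radius \<open>2 s + 5\<close> is the least one that \<open>label_small\<close> admits for this error.
\<close>

definition scale_step :: "int \<Rightarrow> int \<Rightarrow> bool" where
  "scale_step s T \<longleftrightarrow> 0 \<le> T \<and> (\<forall>lab x0. x0 \<in> L \<longrightarrow> (\<forall>z C w. lab z C w \<longrightarrow> w \<in> dirs) \<longrightarrow>
    (\<forall>z\<in>ball1 x0 T. \<forall>C. 2 * s + 5 \<le> C \<and> C \<le> 2 * s + 5 + 2 * int d \<longrightarrow> (\<exists>!w. lab z C w)) \<longrightarrow>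
    (\<forall>z C w. z \<in> ball1 x0 T \<and> shift z w 1 \<in> ball1 x0 T \<and> 2 * s + 5 < C \<and> C \<le> 2 * s + 5 + 2 * int d \<and>
        lab z C w \<longrightarrow> lab (shift z w 1) (C - 1) w) \<longrightarrow>
    (\<exists>x\<in>L. \<forall>y\<in>ball1 x 1. \<exists>w\<in>dirs. lab (shift y w (- (2 * s + 5))) (2 * s + 5) w))"

lemma scale_step_exists: "0 \<le> s \<Longrightarrow> \<exists>T. scale_step s T"
  using tips_everywhere[of "nat (2 * s + 5)"] unfolding scale_step_def by simp

text \<open>
  The \<open>2 d + 1\<close> scales for \<open>relatively_dense\<close>.  A ball of radius \<open>scales (Suc i)\<close> has room for
  \<open>tips_everywhere\<close> even after being shrunk by the error \<open>scales i\<close>.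
\<close>

definition scales :: "nat \<Rightarrow> int" where
  "scales = rec_nat 0 (\<lambda>_ s. (SOME T. scale_step s T) + s)"

lemma scales_nonneg: "0 \<le> scales i"
  and scales_Suc: "scale_step (scales i) (scales (Suc i) - scales i)"
proof -
  have *: "0 \<le> scales i \<and> scale_step (scales i) (scales (Suc i) - scales i)" for i
  proof (induction i)
    case 0
    then show ?case using someI_ex[OF scale_step_exists[of 0]] by (simp add: scales_def)
  next
    case (Suc i)
    then have "0 \<le> scales (Suc i)" by (simp add: scale_step_def)
    then show ?case using someI_ex[OF scale_step_exists[of "scales (Suc i)"]]
      by (simp add: scales_def)
  qed
  show "0 \<le> scales i" "scale_step (scales i) (scales (Suc i) - scales i)" using * by blast+
qed

lemma induced_degree:
  assumes "induced_path d P" "x \<in> set P"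
  shows "card {y \<in> set P. adj x y} \<le> 2"
proof -
  obtain i where i: "i < length P" "x = P ! i" using assms(2) by (metis in_set_conv_nth)
  have "{y \<in> set P. adj x y} \<subseteq> {P ! (i - 1), P ! (i + 1)}"
  proof
    fix y assume "y \<in> {y \<in> set P. adj x y}"
    then have y: "y \<in> set P" "adj x y" by auto
    then obtain j where j: "j < length P" "y = P ! j" by (metis in_set_conv_nth)
    have "i \<noteq> j" using y(2) i j by (auto simp: adj_iff)
    moreover have "\<not> i + 1 < j" "\<not> j + 1 < i"
      using assms(1) y(2) i j adj_commute unfolding induced_path_def by blast+
    ultimately have "j = i - 1 \<or> j = i + 1" by linarith
    then show "y \<in> {P ! (i - 1), P ! (i + 1)}" using j by auto
  qed
  then have "card {y \<in> set P. adj x y} \<le> card {P ! (i - 1), P ! (i + 1)}"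
    by (intro card_mono) auto
  also have "\<dots> \<le> 2" by (simp add: card_insert_if)
  finally show ?thesis .
qed

lemma no_full_ball:
  assumes "induced_path d R" "induced_path d G" "no_red_green_adjacent d R G" "x \<in> L"
  shows "\<not> ball1 x 1 \<subseteq> set R \<union> set G"
proof
  assume sub: "ball1 x 1 \<subseteq> set R \<union> set G"
  have False if P: "induced_path d P" "x \<in> set P" "set R \<union> set G = set P \<union> set Q"
    "\<And>y. y \<in> set Q \<Longrightarrow> \<not> adj x y" for P Q
  proof -
    let ?S = "{shift x (0, 1) 1, shift x (0, -1) 1, shift x (1, 1) 1}"
    have u: "(0, 1) \<in> dirs" "(0, -1) \<in> dirs" "(1, 1) \<in> dirs"
      using two_le_d by (auto simp: dirs_def)
    have a: "adj x (shift x u 1)" if "u \<in> dirs" for u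
      using adj_shift[OF that assms(4), of 0 1] by simp
    have "y \<in> set P" if "adj x y" for y
    proof -
      have "y \<in> ball1 x 1" using that by (simp add: adj_iff ball1_def)
      then show ?thesis using sub P(3,4) that by blast
    qed
    then have "?S \<subseteq> {y \<in> set P. adj x y}" using a u by blast
    then have "card ?S \<le> card {y \<in> set P. adj x y}" by (intro card_mono) auto
    moreover have "card ?S = 3"
    proof -
      have "shift x (0, 1) 1 0 \<noteq> shift x (0, -1) 1 0" "shift x (0, 1) 1 0 \<noteq> shift x (1, 1) 1 0"
        "shift x (0, -1) 1 0 \<noteq> shift x (1, 1) 1 0" by (simp_all add: shift_def)
      then have "shift x (0, 1) 1 \<noteq> shift x (0, -1) 1" "shift x (0, 1) 1 \<noteq> shift x (1, 1) 1"
        "shift x (0, -1) 1 \<noteq> shift x (1, 1) 1" by metis+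
      then show ?thesis by simp
    qed
    ultimately show False using induced_degree[OF P(1,2)] by simp
  qed
  note one = this
  have "x \<in> ball1 x 1" using assms(4) by (simp add: ball1_def)
  then consider "x \<in> set R" | "x \<in> set G" using sub by blast
  then show False
  proof cases
    case 1
    then show False using one[of R G] assms by (auto simp: no_red_green_adjacent_def)
  next
    case 2
    then show False using one[of G R] assms adj_commute
      by (auto simp: no_red_green_adjacent_def)
  qed
qed

lemma walk_shortcut:
  assumes "walk W"
  shows "\<exists>P. is_path d P \<and> hd P = hd W \<and> last P = last W \<and> set P \<subseteq> set W"
  using assms
proof (induction W)
  case (Cons x W)
  show ?case
  proof (cases "W = []")
    case True
    then show ?thesis using Cons by (intro exI[of _ "[x]"]) (auto simp: is_path_def)
  next
    case False
    then have W: "walk W" "adj x (hd W)" "x \<in> L"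
      using Cons(2) by (auto simp: walk_def successively_Cons)
    then obtain P where P: "is_path d P" "hd P = hd W" "last P = last W" "set P \<subseteq> set W"
      using Cons(1) by blast
    show ?thesis
    proof (cases "x \<in> set P")
      case True
      then obtain ys zs where ys: "P = ys @ x # zs" by (meson split_list)
      then have "is_path d (x # zs)"
        using P(1) by (auto simp: is_path_def successively_append_iff)
      then show ?thesis using ys P False by (intro exI[of _ "x # zs"]) auto
    next
      case False
      have "is_path d (x # P)"
        using P False W by (cases P) (auto simp: is_path_def)
      then show ?thesis using P \<open>W \<noteq> []\<close> by (intro exI[of _ "x # P"]) (auto simp: is_path_def)
    qed
  qed
qed (simp add: walk_def)

definition outer_radius :: "int \<Rightarrow> int" where
  "outer_radius N = 6 * scales (2 * d) + N + 4 * int d + 25"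

end

context stuck begin

text \<open>
  Labels of large balls about points near the origin give a relatively dense label \<open>w\<close>; this labels
  all small balls about points near \<open>x' + (K - s - 3) w\<close>.
\<close>

lemma full_ball:
  assumes r: "outer_radius N \<le> r"
  shows "\<exists>x\<in>L. ball1 x 1 \<subseteq> set R \<union> set G"
proof -
  define n where "n = scales (2 * d)"
  define K where "K = 3 * n + N + 2 * int d + 20"
  have n: "0 \<le> n" unfolding n_def by (rule scales_nonneg)
  have rK: "3 * n + K + 2 * int d + 5 \<le> r" using r by (simp add: outer_radius_def n_def K_def)
  define f where "f z = (SOME w. label z K w)" for z
  have f: "label z K (f z)" if "z \<in> ball1 origin n" for z
    unfolding f_def
  proof (rule someI_ex, rule label_big)
    show "z \<in> L" using that by (simp add: ball1_def)
    have "dist1 origin z \<le> n" using that by (simp add: ball1_def)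
    then show "2 * dist1 origin z + N + 12 \<le> K" "dist1 origin z + K \<le> r"
      using n rK by (simp_all add: K_def)
  qed
  have "\<exists>i<2 * d. \<exists>x'\<in>L. \<exists>w\<in>dirs. ball1 x' (scales (Suc i)) \<subseteq> ball1 origin (scales (2 * d)) \<and>
     (\<forall>c\<in>L. ball1 c (scales i) \<subseteq> ball1 x' (scales (Suc i)) \<longrightarrow> (\<exists>y\<in>ball1 c (scales i). f y = w))"
    by (rule relatively_dense)
      (use f card_dirs scales_nonneg in \<open>auto simp: n_def label_def\<close>)
  then obtain i x' w where x': "x' \<in> L" and w: "w \<in> dirs"
    and sub: "ball1 x' (scales (Suc i)) \<subseteq> ball1 origin n"
    and dense: "\<And>c. c \<in> L \<Longrightarrow> ball1 c (scales i) \<subseteq> ball1 x' (scales (Suc i)) \<Longrightarrow>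
       \<exists>y\<in>ball1 c (scales i). f y = w"
    unfolding n_def by blast
  define s where "s = scales i"
  define T where "T = scales (Suc i) - s"
  have s: "0 \<le> s" unfolding s_def by (rule scales_nonneg)
  have T: "scale_step s T" unfolding s_def T_def by (rule scales_Suc)
  then have T0: "0 \<le> T" by (simp add: scale_step_def)
  define x0 where "x0 = shift x' w (K - s - 3)"
  have x0: "x0 \<in> L" using x' w by (simp add: x0_def)
  have sn: "s \<le> n"
  proof -
    have "shift x' v s \<in> ball1 origin n" if "v \<in> dirs" for v
    proof -
      have "shift x' v s \<in> ball1 x' (scales (Suc i))"
        using that x' s T0 by (simp add: ball1_def T_def)
      then show ?thesis using sub by blast
    qed
    then have a: "dist1 origin (shift x' w s) \<le> n" "dist1 origin (shift x' (opp w) s) \<le> n"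
      using w by (auto simp: ball1_def)
    have "dist1 (shift x' w s) (shift x' (opp w) s) = 2 * s"
      using w s dist1_shift[OF w, of x' s "- s"] by (simp add: shift_opp)
    then show ?thesis
      using a dist1_triangle[of "shift x' w s" "shift x' (opp w) s" origin]
      by (simp add: dist1_commute)
  qed
  have ex: "\<exists>v. label z C v" if z: "z \<in> ball1 x0 T" and C: "2 * s + 5 \<le> C" "C \<le> 2 * s + 5 + 2 * int d" for z C
  proof -
    \<comment> \<open>The large ball to be used has its centre within distance s of c.\<close>
    define c where "c = shift z w (- (K - s - 3))"
    have cL: "c \<in> L" using z w by (simp add: c_def ball1_def)
    have "dist1 x' c = dist1 (shift x0 w (- (K - s - 3))) c" by (simp add: x0_def)
    also have "\<dots> = dist1 x0 z" unfolding c_def by (rule dist1_shift_both)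
    finally have dc: "dist1 x' c \<le> T" using z by (simp add: ball1_def)
    have cs: "ball1 c s \<subseteq> ball1 x' (scales (Suc i))"
      by (rule ball1_subset) (use dc in \<open>simp add: T_def\<close>)
    then obtain y where y: "y \<in> ball1 c s" "f y = w" using dense[OF cL] by (auto simp: s_def)
    have "y \<in> ball1 origin n" using y(1) cs sub by blast
    then have lab: "label y K w" using f y(2) by metis
    have "c \<in> ball1 c s" using cL s by (simp add: ball1_def)
    then have co: "dist1 origin c \<le> n" using cs sub by (auto simp: ball1_def)
    have zc: "z = shift c w (K - s - 3)" by (simp add: c_def)
    have Ks: "0 \<le> K - s - 3" using sn n m by (simp add: K_def)
    have zo: "dist1 origin z \<le> n + (K - s - 3)"
    proof -
      have "dist1 origin z \<le> dist1 origin c + dist1 c z" by (rule dist1_triangle)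
      also have "dist1 c z = K - s - 3" unfolding zc using w Ks by simp
      finally show ?thesis using co by simp
    qed
    show ?thesis
      by (rule label_small[OF cL y(1) lab zc s C(1)]) (use C co zo sn n rK m s in \<open>simp_all add: K_def\<close>)
  qed
  have uniq: "\<exists>!v. label z C v" if "z \<in> ball1 x0 T" "2 * s + 5 \<le> C" "C \<le> 2 * s + 5 + 2 * int d" for z C
    using ex[OF that] label_unique[of z C] that s by auto
  have "\<exists>x\<in>L. \<forall>y\<in>ball1 x 1. \<exists>v\<in>dirs. label (shift y v (- (2 * s + 5))) (2 * s + 5) v"
    using T x0 unfolding scale_step_def
  proof (elim conjE allE impE)
    show "\<forall>z C v. label z C v \<longrightarrow> v \<in> dirs" by (simp add: label_def)
    show "\<forall>z\<in>ball1 x0 T. \<forall>C. 2 * s + 5 \<le> C \<and> C \<le> 2 * s + 5 + 2 * int d \<longrightarrow> (\<exists>!v. label z C v)"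
      using uniq by blast
    show "\<forall>z C v. z \<in> ball1 x0 T \<and> shift z v 1 \<in> ball1 x0 T \<and> 2 * s + 5 < C \<and>
        C \<le> 2 * s + 5 + 2 * int d \<and> label z C v \<longrightarrow> label (shift z v 1) (C - 1) v"
    proof (intro allI impI, elim conjE)
      fix z C v
      assume "shift z v 1 \<in> ball1 x0 T" "2 * s + 5 < C" "C \<le> 2 * s + 5 + 2 * int d" "label z C v"
      then show "label (shift z v 1) (C - 1) v"
        using label_down[of z C v] ex[of "shift z v 1" "C - 1"] s by force
    qed
  qed auto
  then obtain x where x: "x \<in> L" "\<And>y. y \<in> ball1 x 1 \<Longrightarrow>
      \<exists>v\<in>dirs. label (shift y v (- (2 * s + 5))) (2 * s + 5) v" by blast
  have "y \<in> set R \<union> set G" if y: "y \<in> ball1 x 1" for y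
  proof -
    obtain v where "label (shift y v (- (2 * s + 5))) (2 * s + 5) v" using x(2)[OF y] by blast
    from label_coloured[OF this] show ?thesis by simp
  qed
  then show ?thesis using x(1) by blast
qed

end

theorem mainTheorem3:
  fixes d m :: nat and \<delta> :: "point \<Rightarrow> point \<Rightarrow> int"
  assumes "d \<ge> 2" and "m \<ge> 1"
    and "\<delta> = l1_dist d \<or> \<delta> = linf_dist d"
  shows "\<exists>r::nat. r > 0 \<and>
    (\<forall>P\<^sub>R P\<^sub>G.
       induced_path d P\<^sub>R \<and> induced_path d P\<^sub>G \<and>
       hd P\<^sub>R \<notin> origin_ball d \<delta> (r + 2) \<and> hd P\<^sub>G \<notin> origin_ball d \<delta> (r + 2) \<and>
       adjacent d (last P\<^sub>R) origin \<and> adjacent d (last P\<^sub>G) origin \<and>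
       no_red_green_adjacent d P\<^sub>R P\<^sub>G
     \<longrightarrow>
       (\<exists>P\<^sub>R' P\<^sub>G'.
          modification_inside d (origin_ball d \<delta> r) P\<^sub>R P\<^sub>R' \<and>
          modification_inside d (origin_ball d \<delta> r) P\<^sub>G P\<^sub>G' \<and>
          ((ends_at_only P\<^sub>R' (axis_site (- int m)) (origin_ball d \<delta> m) \<and>
            ends_at_only P\<^sub>G' (axis_site (int m)) (origin_ball d \<delta> m)) \<or>
           (ends_at_only P\<^sub>R' (axis_site (int m)) (origin_ball d \<delta> m) \<and>
            ends_at_only P\<^sub>G' (axis_site (- int m)) (origin_ball d \<delta> m))) \<and>
          no_red_green_adjacent d P\<^sub>R' P\<^sub>G'))"
proof -
  interpret grid d by unfold_locales (rule assms(1))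
  define N where "N = int (d * m)"
  have mN: "1 \<le> int m" "int m \<le> N" using assms by (auto simp: N_def)
  define r where "r = nat (outer_radius N)"
  have r: "int r = outer_radius N"
    unfolding r_def outer_radius_def using scales_nonneg[of "2 * d"] by (simp add: N_def)
  have r0: "0 < r" using r scales_nonneg[of "2 * d"] unfolding outer_radius_def N_def by linarith
  have linf: "linf_dist d x y \<le> k \<longleftrightarrow> (\<forall>i<d. \<bar>x i - y i\<bar> \<le> k)" for x y k
    unfolding linf_dist_def using assms(1) by (subst Max_le_iff) (auto simp: lessThan_empty_iff)
  have \<delta>_coord: "\<bar>x i - y i\<bar> \<le> \<delta> x y" if "i < d" for x y i
    using assms(3) that coordinate_le linf[of x y "linf_dist d x y"] by auto
  have \<delta>_le: "\<delta> x y \<le> dist1 x y" for x y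
    using assms(3) linf[of x y "dist1 x y"] coordinate_le by auto
  have \<delta>_ge: "dist1 x y \<le> int d * \<delta> x y" for x y
  proof -
    have "dist1 x y \<le> (\<Sum>i<d. \<delta> x y)" unfolding l1_dist_def by (rule sum_mono) (use \<delta>_coord in auto)
    then show ?thesis by simp
  qed
  show ?thesis
  proof (intro exI[of _ r] conjI r0 allI impI, elim conjE)
    fix R G
    assume R: "induced_path d R" and G: "induced_path d G"
      and hR: "hd R \<notin> origin_ball d \<delta> (r + 2)" and hG: "hd G \<notin> origin_ball d \<delta> (r + 2)"
      and lR: "adjacent d (last R) origin" and lG: "adjacent d (last G) origin"
      and RG: "no_red_green_adjacent d R G"
    let ?B = "origin_ball d \<delta> r" and ?Bm = "origin_ball d \<delta> m"
    let ?goal = "\<exists>R' G'. modification_inside d ?B R R' \<and> modification_inside d ?B G G' \<and>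
          ((ends_at_only R' (axis_site (- int m)) ?Bm \<and> ends_at_only G' (axis_site (int m)) ?Bm) \<or>
           (ends_at_only R' (axis_site (int m)) ?Bm \<and> ends_at_only G' (axis_site (- int m)) ?Bm)) \<and>
          no_red_green_adjacent d R' G'"
    have wR: "walk R" and wG: "walk G"
      using R G by (auto simp: induced_path_def is_path_def walk_def)
    have out: "hd P \<notin> ball1 origin (int r)" if "hd P \<notin> origin_ball d \<delta> (r + 2)" for P
      using that \<delta>_le[of origin "hd P"] by (auto simp: origin_ball_def ball1_def)
    have inB: "ball1 origin (int r) \<subseteq> ?B"
    proof
      fix x assume "x \<in> ball1 origin (int r)"
      then show "x \<in> ?B" using \<delta>_le[of origin x] by (auto simp: origin_ball_def ball1_def)
    qed
    have disj: "set R \<inter> set G = {}"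
    proof (rule ccontr)
      assume "\<not> ?thesis"
      then obtain x where x: "x \<in> set R" "x \<in> set G" by blast
      have "hd R \<noteq> last R"
      proof
        assume "hd R = last R"
        then have "dist1 origin (hd R) = 1" using lR by (simp add: adj_iff dist1_commute)
        then show False using out[OF hR] lR \<open>hd R = last R\<close> r0 by (simp add: ball1_def adj_iff)
      qed
      moreover have "R \<noteq> []" using wR by (simp add: walk_def)
      ultimately have len: "2 \<le> length R" by (cases R; cases "tl R") auto
      obtain i where i: "i < length R" "x = R ! i" using x(1) by (metis in_set_conv_nth)
      have succ: "adjacent d (R ! j) (R ! Suc j)" if "Suc j < length R" for j
        using wR that by (simp add: walk_def successively_conv_nth)
      have "\<exists>y\<in>set R. adjacent d y x"
      proof (cases i)
        case 0
        then show ?thesis using succ[of 0] len i adj_commute by (intro bexI[of _ "R ! 1"]) auto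
      next
        case (Suc j)
        then show ?thesis using succ[of j] i by (intro bexI[of _ "R ! j"]) auto
      qed
      then show False using x(2) RG by (auto simp: no_red_green_adjacent_def)
    qed
    show ?goal
    proof (rule ccontr)
      assume no: "\<not> ?goal"
      have "stuck d R G (int m) N (int r)"
      proof unfold_locales
        show "walk R" "walk G" "no_red_green_adjacent d R G" "set R \<inter> set G = {}"
          "adjacent d (last R) origin" "adjacent d (last G) origin" "1 \<le> int m" "int m \<le> N"
          by fact+
        show "hd R \<notin> ball1 origin (int r)" "hd G \<notin> ball1 origin (int r)" using out hR hG by blast+
        fix P Q xs ys
        assume P: "R = P @ xs" "P \<noteq> []" and Q: "G = Q @ ys" "Q \<noteq> []"
        show "\<not> finished (int m) N (ball1 origin (int r)) P Q"
        proof
          assume "finished (int m) N (ball1 origin (int r)) P Q"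
          then obtain f P1 Q1 where f: "f \<in> dirs" "fst f = 0" and w1: "walk P1" "walk Q1"
            and h1: "hd P1 = hd P" "hd Q1 = hd Q" and a1: "no_red_green_adjacent d P1 Q1"
            and l1: "last P1 = shift origin f (int m)" "last Q1 = shift origin (opp f) (int m)"
            and s1: "set P1 \<subseteq> set P \<union> ball1 origin (int r)" "set Q1 \<subseteq> set Q \<union> ball1 origin (int r)"
            and t1: "\<forall>x\<in>set P1. N < dist1 origin x \<or> (\<exists>t\<ge>int m. x = shift origin f t)"
              "\<forall>x\<in>set Q1. N < dist1 origin x \<or> (\<exists>t\<ge>int m. x = shift origin (opp f) t)"
            unfolding finished_def by blast
          obtain P2 where P2: "is_path d P2" "hd P2 = hd P1" "last P2 = last P1" "set P2 \<subseteq> set P1"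
            using walk_shortcut[OF w1(1)] by blast
          obtain Q2 where Q2: "is_path d Q2" "hd Q2 = hd Q1" "last Q2 = last Q1" "set Q2 \<subseteq> set Q1"
            using walk_shortcut[OF w1(2)] by blast
          have modP: "modification_inside d ?B R P2"
            unfolding modification_inside_def using P P2 h1(1) s1(1) inB by auto
          have modQ: "modification_inside d ?B G Q2"
            unfolding modification_inside_def using Q Q2 h1(2) s1(2) inB by auto
          have ends: "ends_at_only W (shift origin u (int m)) ?Bm"
            if u: "u \<in> dirs" "fst u = 0" and W: "last W = shift origin u (int m)"
              "\<forall>x\<in>set W. N < dist1 origin x \<or> (\<exists>t\<ge>int m. x = shift origin u t)" for W u
          proof -
            have "x = shift origin u (int m)" if x: "x \<in> set W" "x \<in> ?Bm" for x
            proof -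
              have d: "\<delta> origin x \<le> int m" using x(2) by (simp add: origin_ball_def)
              then have "int d * \<delta> origin x \<le> N" by (simp add: N_def mult_left_mono)
              then have "dist1 origin x \<le> N" using \<delta>_ge[of origin x] by linarith
              then obtain t where t: "int m \<le> t" "x = shift origin u t" using W(2) x(1) by force
              have "\<bar>origin 0 - x 0\<bar> \<le> int m" using \<delta>_coord[of 0 origin x] assms(1) d by simp
              then have "t \<le> int m"
                using t u dirsD[OF u(1)] by (auto simp: shift_def origin_def)
              then show ?thesis using t by simp
            qed
            then show ?thesis using W(1) by (auto simp: ends_at_only_def)
          qed
          have eP: "ends_at_only P2 (shift origin f (int m)) ?Bm"
            by (rule ends[OF f]) (use P2 l1 t1 in auto)
          have eQ: "ends_at_only Q2 (shift origin (opp f) (int m)) ?Bm"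
          proof (rule ends)
            show "opp f \<in> dirs" "fst (opp f) = 0" using f by (simp, simp add: opp_def)
          qed (use Q2 l1 t1 in auto)
          have ap: "apart P2 Q2" using a1 P2(4) Q2(4) unfolding no_red_green_adjacent_def by blast
          have axis: "shift origin (0, 1) (int m) = axis_site (int m)"
            "shift origin (0, -1) (int m) = axis_site (- int m)"
            by (auto simp: shift_def axis_site_def origin_def)
          have "f = (0, 1) \<or> f = (0, -1)" using f dirsD[OF f(1)] by (cases f) auto
          then have "(ends_at_only P2 (axis_site (- int m)) ?Bm \<and> ends_at_only Q2 (axis_site (int m)) ?Bm) \<or>
            (ends_at_only P2 (axis_site (int m)) ?Bm \<and> ends_at_only Q2 (axis_site (- int m)) ?Bm)"
            using eP eQ axis by (auto simp: opp_def)
          then show False using no modP modQ ap by blast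
        qed
      qed
      then obtain x where "x \<in> L" "ball1 x 1 \<subseteq> set R \<union> set G"
        using stuck.full_ball[of d R G "int m" N "int r"] r by auto
      then show False using no_full_ball[OF R G RG] by blast
    qed
  qed
qed

end
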